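(* In the formal power series ring $\mathcal{Z}[t,x,y][[X,Y,Z]]$ (with $t,x,y,X,Y,Z$ indeterminates) we have \[ \Phi_{x,y}^t(X,Y,Z)=\Phi^t(xX,xY,x^2Z)-\Phi^{1-t}(yX,yY,y^2Z)\exp\Biggl(\sum_{k=2}^{\infty}\frac{\zeta(k)}{k}(x^k+y^k)\bigl(\gamma_t^k+\delta_t^k-\gamma_{1-t}^k-\delta_{1-t}^k\bigr)\Biggr), \] where $\gamma_t=\alpha_{t(1-2t)}$ and $\delta_t=\beta_{t(1-2t)}$ (so $\gamma_{1-t}=\alpha_{(1-t)(2t-1)}$, $\delta_{1-t}=\beta_{(1-t)(2t-1)}$), and for a parameter $s$, $\alpha_s,\beta_s$ are the two roots of $T^2-(X+sY)T+s(XY-Z)$, i.e. $\alpha_s+\beta_s=X+sY$ and $\alpha_s\beta_s=s(XY-Z)$ (the expression $\gamma_t^k+\delta_t^k$ is symmetric in the roots and hence a polynomial in $t,X,Y,Z$).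
   Context: An index is a finite (possibly empty) sequence of positive integers; it is admissible if it is empty or its last component is $>1$. Let $I$ be the set of nonempty admissible indices. For an admissible index $(k_1,\dots,k_r)$, $\zeta(k_1,\dots,k_r)=\sum_{1\le n_1<\dots<n_r}n_1^{-k_1}\cdots n_r^{-k_r}$, extended to all indices by harmonic regularization (the extension compatible with the harmonic/stuffle product with $\zeta(1)=0$); $\zeta(\emptyset)=1$. Let $\mathcal{Z}$ be the $\mathbb{Q}$-span of all multiple zeta values. For an index $(k_1,\dots,k_r)$, the interpolated multiple zeta value $\zeta^t(k_1,\dots,k_r)\in\mathcal{Z}[t]$ is $\sum t^{m}\zeta(\boldsymbol{p})$, summed over the $2^{r-1}$ indices $\boldsymbol{p}$ obtained from $(k_1,\dots,k_r)$ by replacing each comma either by "$+$" or keeping it, $m$ being the number of "$+$" used; for admissible indices this equals $\sum_{1\le n_1\le\dots\le n_r}t^{e(n_1,\dots,n_r)}n_1^{-k_1}\cdots n_r^{-k_r}$ where $e$ counts the $i$ with $n_i=n_{i+1}$; $\zeta^t(\emptyset)=1$. The interpolated polynomial multiple zeta value of an index $(k_1,\dots,k_r)$ is $\zeta_{x,y}^t(k_1,\dots,k_r)=\sum_{i=0}^{r}\zeta^t(k_1,\dots,k_i)\zeta^t(k_r,\dots,k_{i+1})x^{k_1+\dots+k_i}y^{k_{i+1}+\dots+k_r}$. For an index $\boldsymbol{k}$ with weight $\mathrm{wt}=k_1+\dots+k_r$, depth $\mathrm{dep}=r$, height $\mathrm{ht}=\#\{i:k_i\ge2\}$, put $u_{\boldsymbol{k}}=X^{\mathrm{wt}-\mathrm{dep}-\mathrm{ht}}Y^{\mathrm{dep}-\mathrm{ht}}Z^{\mathrm{ht}}$.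 Define $\Phi^t(X,Y,Z)=\sum_{\boldsymbol{k}\in I}(1-2t)^{\mathrm{dep}(\boldsymbol{k})}\zeta^t(\boldsymbol{k})u_{\boldsymbol{k}}$ and $\Phi_{x,y}^t(X,Y,Z)=\sum_{\boldsymbol{k}\in I}(1-2t)^{\mathrm{dep}(\boldsymbol{k})}\zeta_{x,y}^t(\boldsymbol{k})u_{\boldsymbol{k}}$; $\Phi^{1-t}$ is $\Phi^t$ with $t$ replaced by $1-t$. *)

theory Defs
  imports "HOL-Algebra.Algebraic_Closure_Type" "HOL-Analysis.Analysis"
begin

section \<open>Indices and multiple zeta values\<close>

definition is_index :: "nat list \<Rightarrow> bool" where
  "is_index k \<longleftrightarrow> (\<forall>a\<in>set k. a \<ge> 1)"

definition admissible :: "nat list \<Rightarrow> bool" where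
  "admissible k \<longleftrightarrow> is_index k \<and> (k = [] \<or> last k > 1)"

definition indices_I :: "nat list set" where
  "indices_I = {k. admissible k \<and> k \<noteq> []}"

definition wt :: "nat list \<Rightarrow> nat" where
  "wt k = sum_list k"

definition dep :: "nat list \<Rightarrow> nat" where
  "dep k = length k"

definition ht :: "nat list \<Rightarrow> nat" where
  "ht k = length (filter (\<lambda>a. a \<ge> 2) k)"

definition mzv :: "nat list \<Rightarrow> real" where
  "mzv k = (\<Sum>\<^sub>\<infinity> n \<in> {n. length n = length k \<and> (\<forall>j\<in>set n. j \<ge> 1) \<and> sorted_wrt (<) n}.
              \<Prod>i<length k. 1 / real (n ! i) ^ (k ! i))"

text \<open>The harmonic (stuffle) product of two indices, as the list of its terms with multiplicity.\<close>

fun stuffle :: "nat list \<Rightarrow> nat list \<Rightarrow> nat list list" where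
  "stuffle [] l = [l]"
| "stuffle k [] = [k]"
| "stuffle (a # k) (b # l) =
     map ((#) a) (stuffle k (b # l)) @ map ((#) b) (stuffle (a # k) l) @ map ((#) (a + b)) (stuffle k l)"

text \<open>The value \<open>0\<close> on lists that are not indices is only there to make the extension unique.\<close>

definition is_harmonic_regularization :: "(nat list \<Rightarrow> real) \<Rightarrow> bool" where
  "is_harmonic_regularization f \<longleftrightarrow>
     (\<forall>k. admissible k \<longrightarrow> f k = mzv k) \<and>
     f [1] = 0 \<and>
     (\<forall>k l. is_index k \<and> is_index l \<longrightarrow> f k * f l = (\<Sum>p\<leftarrow>stuffle k l. f p)) \<and>
     (\<forall>k. \<not> is_index k \<longrightarrow> f k = 0)"

definition zeta :: "nat list \<Rightarrow> real" where
  "zeta = (THE f. is_harmonic_regularization f)"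

definition mzv_space :: "real set" where
  "mzv_space = module.span (\<lambda>(q::rat) (r::real). of_rat q * r) {mzv k | k. admissible k}"


section \<open>The ambient ring\<close>

text \<open>
  Elements of \<open>\<real>[t,x,y][[X,Y,Z]]\<close>, with \<open>t\<close> the innermost and \<open>y\<close> the outermost polynomial
  indeterminate, and \<open>X\<close> the innermost and \<open>Z\<close> the outermost power series indeterminate.
  The ring \<open>\<Z>[t,x,y][[X,Y,Z]]\<close>, \<open>\<Z>\<close> being \<^const>\<open>mzv_space\<close>, is its subset \<open>mzv_series\<close> below.
\<close>

type_synonym series = "real poly poly poly fps fps fps"

definition poly_const :: "real poly poly poly \<Rightarrow> series" where
  "poly_const p = fps_const (fps_const (fps_const p))"

definition real_const :: "real \<Rightarrow> series" where
  "real_const r = poly_const [:[:[:r:]:]:]"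

definition ind_t :: series where "ind_t = poly_const [:[:[:0, 1:]:]:]"
definition ind_x :: series where "ind_x = poly_const [:[:0, 1:]:]"
definition ind_y :: series where "ind_y = poly_const [:0, 1:]"
definition ind_X :: series where "ind_X = fps_const (fps_const fps_X)"
definition ind_Y :: series where "ind_Y = fps_const fps_X"
definition ind_Z :: series where "ind_Z = fps_X"

text \<open>The coefficient of \<open>X\<^sup>a Y\<^sup>b Z\<^sup>c\<close>.\<close>

definition scoeff :: "series \<Rightarrow> nat \<Rightarrow> nat \<Rightarrow> nat \<Rightarrow> real poly poly poly" where
  "scoeff F a b c = fps_nth (fps_nth (fps_nth F c) b) a"

definition mzv_series :: "series set" where
  "mzv_series = {F. \<forall>a b c i j l.
     Polynomial.coeff (Polynomial.coeff (Polynomial.coeff (scoeff F a b c) l) j) i \<in> mzv_space}"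

text \<open>
  The formal sum of a family in which every monomial \<open>X\<^sup>a Y\<^sup>b Z\<^sup>c\<close> occurs in only finitely many
  members.
  The \<open>fps\<close> topology cannot be used for this, as it treats the inner series as discrete.
\<close>

definition series_sum :: "'i set \<Rightarrow> ('i \<Rightarrow> series) \<Rightarrow> series" where
  "series_sum A f = Abs_fps (\<lambda>c. Abs_fps (\<lambda>b. Abs_fps (\<lambda>a.
     \<Sum>i | i \<in> A \<and> scoeff (f i) a b c \<noteq> 0. scoeff (f i) a b c)))"

text \<open>The exponential of a series without constant term.\<close>

definition series_exp :: "series \<Rightarrow> series" where
  "series_exp F = series_sum UNIV (\<lambda>n. real_const (1 / fact n) * F ^ n)"


section \<open>Interpolated multiple zeta values and their generating series\<close>

text \<open>
  All indices obtained by replacing commas by plus signs, each paired with the number of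
  plus signs used.
\<close>

fun merges :: "nat list \<Rightarrow> (nat \<times> nat list) list" where
  "merges [] = [(0, [])]"
| "merges [a] = [(0, [a])]"
| "merges (a # b # k) =
     map (\<lambda>(m, p). (m, a # p)) (merges (b # k)) @ map (\<lambda>(m, p). (Suc m, p)) (merges ((a + b) # k))"

text \<open>
  The parameters \<open>t, x, y\<close> and \<open>A, B, C\<close> (for \<open>X, Y, Z\<close>) below are arbitrary ring elements, so that
  substitutions such as \<open>t \<mapsto> 1 - t\<close> or \<open>X \<mapsto> xX\<close> are applications to other arguments.
\<close>

definition zeta_t :: "series \<Rightarrow> nat list \<Rightarrow> series" where
  "zeta_t t k = (\<Sum>(m, p)\<leftarrow>merges k. t ^ m * real_const (zeta p))"

definition zeta_txy :: "series \<Rightarrow> series \<Rightarrow> series \<Rightarrow> nat list \<Rightarrow> series" where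
  "zeta_txy t x y k = (\<Sum>i\<le>length k.
     zeta_t t (take i k) * zeta_t t (rev (drop i k)) * x ^ wt (take i k) * y ^ wt (drop i k))"

definition u_monom :: "series \<Rightarrow> series \<Rightarrow> series \<Rightarrow> nat list \<Rightarrow> series" where
  "u_monom A B C k = A ^ (wt k - dep k - ht k) * B ^ (dep k - ht k) * C ^ ht k"

definition Phi :: "series \<Rightarrow> series \<Rightarrow> series \<Rightarrow> series \<Rightarrow> series" where
  "Phi t A B C = series_sum indices_I (\<lambda>k. (1 - 2 * t) ^ dep k * zeta_t t k * u_monom A B C k)"

definition Phi_xy ::
    "series \<Rightarrow> series \<Rightarrow> series \<Rightarrow> series \<Rightarrow> series \<Rightarrow> series \<Rightarrow> series" where
  "Phi_xy t x y A B C =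
     series_sum indices_I (\<lambda>k. (1 - 2 * t) ^ dep k * zeta_txy t x y k * u_monom A B C k)"


section \<open>The roots\<close>

text \<open>
  The roots live in an algebraic closure of the fraction field; symmetric polynomials in them are
  pulled back along the embedding.
\<close>

definition ext_emb :: "series \<Rightarrow> series fract alg_closure" where
  "ext_emb F = to_ac (Fract F 1)"

definition root_pair :: "series \<Rightarrow> series fract alg_closure \<Rightarrow> series fract alg_closure \<Rightarrow> bool" where
  "root_pair s \<alpha> \<beta> \<longleftrightarrow>
     \<alpha> + \<beta> = ext_emb (ind_X + s * ind_Y) \<and> \<alpha> * \<beta> = ext_emb (s * (ind_X * ind_Y - ind_Z))"

definition from_ext :: "series fract alg_closure \<Rightarrow> series" where
  "from_ext = the_inv ext_emb"

lemma ext_emb_simps: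
  "ext_emb (F + G) = ext_emb F + ext_emb G"
  "ext_emb (F - G) = ext_emb F - ext_emb G"
  "ext_emb (F * G) = ext_emb F * ext_emb G"
  by (simp_all add: ext_emb_def flip: to_ac_add to_ac_diff to_ac_mult)

lemma inj_ext_emb: "inj ext_emb"
  by (auto simp: inj_on_def ext_emb_def eq_fract)

lemma from_ext_emb: "from_ext (ext_emb F) = F"
  unfolding from_ext_def by (rule the_inv_f_f[OF inj_ext_emb])

lemma root_pair_exists: "\<exists>\<alpha> \<beta>. root_pair s \<alpha> \<beta>"
proof -
  define e1 e2 where "e1 = ext_emb (ind_X + s * ind_Y)"
    and "e2 = ext_emb (s * (ind_X * ind_Y - ind_Z))"
  have "\<exists>z. poly [:e2, - e1, 1:] z = 0"
    by (rule alg_closed_imp_poly_has_root) simp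
  then obtain z where "poly [:e2, - e1, 1:] z = 0" by blast
  then have "z + (e1 - z) = e1 \<and> z * (e1 - z) = e2"
    by (simp add: algebra_simps)
  then show ?thesis
    unfolding root_pair_def e1_def e2_def by blast
qed

lemma root_pair_power_sum:
  assumes "root_pair s \<alpha> \<beta>"
  shows "\<alpha> ^ k + \<beta> ^ k \<in> range ext_emb"
proof (induction k rule: less_induct)
  case (less k)
  have "1 = ext_emb 1" by (simp add: ext_emb_def flip: One_fract_def)
  then have two: "(2::series fract alg_closure) = ext_emb (1 + 1)"
    by (simp only: ext_emb_simps one_add_one[symmetric])
  consider "k = 0" | "k = 1" | n where "k = Suc (Suc n)"
    by (metis One_nat_def old.nat.exhaust)
  then show ?case
  proof cases
    case 1
    then show ?thesis using two by simp
  next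
    case 2
    then show ?thesis using assms by (simp add: root_pair_def)
  next
    case 3
    obtain F G where "\<alpha> ^ Suc n + \<beta> ^ Suc n = ext_emb F" "\<alpha> ^ n + \<beta> ^ n = ext_emb G"
      using less.IH[of "Suc n"] less.IH[of n] 3 by auto
    moreover have "\<alpha> ^ k + \<beta> ^ k =
        (\<alpha> + \<beta>) * (\<alpha> ^ Suc n + \<beta> ^ Suc n) - (\<alpha> * \<beta>) * (\<alpha> ^ n + \<beta> ^ n)"
      using 3 by (simp add: algebra_simps)
    ultimately have "\<alpha> ^ k + \<beta> ^ k =
        ext_emb ((ind_X + s * ind_Y) * F - s * (ind_X * ind_Y - ind_Z) * G)"
      using assms by (simp only: root_pair_def ext_emb_simps)
    then show ?thesis by blast
  qed
qed

text \<open>The exponent, given the root pairs \<open>(\<gamma>, \<delta>)\<close> and \<open>(\<gamma>', \<delta>')\<close> of the two parameters.\<close>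

definition exponent ::
    "series \<Rightarrow> series \<Rightarrow> series fract alg_closure \<Rightarrow> series fract alg_closure \<Rightarrow>
     series fract alg_closure \<Rightarrow> series fract alg_closure \<Rightarrow> series" where
  "exponent x y \<gamma> \<delta> \<gamma>' \<delta>' = series_sum {2..} (\<lambda>k.
     real_const (zeta [k] / real k) * (x ^ k + y ^ k) *
     from_ext (\<gamma> ^ k + \<delta> ^ k - \<gamma>' ^ k - \<delta>' ^ k))"

end

theory Submission
  imports Defs
begin

text \<open>
  Truncate every sum at \<open>n\<^sub>r \<le> N\<close>. With weights multiplicative under concatenation, the summands
  with \<open>n\<^sub>i = n\<close> contribute a geometric series, so the generating series \<open>A\<close> over all indices is a
  product over \<open>n \<le> N\<close> of \<open>(1 - \<gamma>'/n)(1 - \<delta>'/n) / ((1 - \<gamma>/n)(1 - \<delta>/n))\<close>; its logarithmic derivative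
  is a combination of power sums with coefficients \<open>\<Sum>\<^bsub>n\<le>N\<^esub> n\<^sup>-\<^sup>k\<close>. Likewise the series \<open>B\<close> over
  the indices with first entry \<open>> 1\<close> satisfies \<open>B = - \<Phi>\<^bsup>1-t\<^esup> A\<close> (an antipode relation), because both
  sides obey the same recursion in \<open>N\<close>. Truncated multiple zeta values are, up to an error that is
  negligible against every power of the harmonic number \<open>H\<^sub>N\<close>, polynomials in \<open>H\<^sub>N\<close>, and taking the
  constant term of that polynomial is the harmonic regularization; being multiplicative, it carries
  both identities to the limit. Finally, cutting each index of \<open>\<Phi>\<^sub>x\<^sub>,\<^sub>y\<close> at \<open>i\<close> gives
  \<open>\<Phi>\<^sub>x\<^sub>,\<^sub>y = \<Phi>(x) + A(x) B(y)\<close>, and \<open>A(x) A(y)\<close> is the exponential in the theorem.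
\<close>

section \<open>Truncated multiple zeta values\<close>

text \<open>Regularized values of non-admissible indices are not limits of sums, so the identities
  are proved where every sum is finite and transferred afterwards; this is why the recursions are
  stated for an arbitrary list \<open>xs\<close> of reals. Their denominators are never inverted: a
  factor with constant term 1 is multiplied in and later cancelled in a domain. A second obstacle is
  that the formal sums in X, Y, Z are infinite. A further variable q recording the weight (X and Y
  of weight 1, Z of weight 2) makes every coefficient a finite sum, and lets the exponential be
  recognised by its differential equation in q. The factor (1-2t)^dep makes the two sides fit: 1-2t
  changes sign under t -> 1-t, so passing to \<open>Phi (1 - t)\<close> negates the weight of every
  letter, as the antipode relation demands. With the factor h = 1-2t on each letter, 1 - c times the
  letter series at 1/n becomes, after clearing 1 - Xq/n, a quadratic in q with parameter s = c h; c
  = t and c = t-1 give the two parameters of the theorem.\<close>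

text \<open>Monomial quasi-symmetric functions; at the list \<open>1/1, \<dots>, 1/N\<close> they are the truncated
  multiple zeta values.\<close>

fun qsym :: "real list \<Rightarrow> nat list \<Rightarrow> real" where
  "qsym xs [] = 1"
| "qsym [] (a # k) = 0"
| "qsym (x # xs) (a # k) = qsym xs (a # k) + x ^ a * qsym xs k"

lemma stuffle_Nil_right [simp]: "stuffle k [] = [k]"
  by (cases k) auto

text \<open>Induction on the evaluation points, not on the indices: the first point is taken by
  neither index, by one of them, or by both, and the last three cases are the branches of
  \<open>stuffle\<close>.\<close>

theorem qsym_stuffle: "qsym xs k * qsym xs l = (\<Sum>p\<leftarrow>stuffle k l. qsym xs p)"
proof (induction xs arbitrary: k l)
  case Nil
  show ?case by (cases k; cases l) (auto simp: o_def)
next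
  case (Cons x xs)
  show ?case
  proof (cases "k = [] \<or> l = []")
    case True
    then show ?thesis by auto
  next
    case False
    then obtain a k' b l' where kl: "k = a # k'" "l = b # l'"
      by (meson list.exhaust)
    have "qsym (x # xs) k * qsym (x # xs) l =
        qsym xs (a # k') * qsym xs (b # l') + x ^ a * (qsym xs k' * qsym xs (b # l'))
        + x ^ b * (qsym xs (a # k') * qsym xs l') + x ^ (a + b) * (qsym xs k' * qsym xs l')"
      by (simp add: kl algebra_simps power_add)
    also have "\<dots> = (\<Sum>p\<leftarrow>stuffle k l. qsym (x # xs) p)"
      unfolding Cons.IH by (simp add: kl o_def sum_list_addf sum_list_const_mult)
    finally show ?thesis .
  qed
qed

text \<open>The defining recursion splits off the first evaluation point, whereas letting N grow
  appends a point at the other end.\<close>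

lemma qsym_snoc: "qsym (xs @ [x]) (k @ [a]) = qsym xs (k @ [a]) + x ^ a * qsym xs k"
proof (induction xs arbitrary: k)
  case Nil
  show ?case by (cases k; cases "tl k") auto
next
  case (Cons y xs)
  show ?case
    by (cases k) (auto simp: Cons.IH[of "[]", simplified] Cons.IH[of "_ # _", simplified]
      Cons.IH algebra_simps)
qed

lemma qsym_nonneg: "(\<And>x. x \<in> set xs \<Longrightarrow> x \<ge> 0) \<Longrightarrow> qsym xs k \<ge> 0"
  by (induction xs k rule: qsym.induct) auto

definition recips :: "nat \<Rightarrow> real list" where
  "recips N = map (\<lambda>n. 1 / real n) [1..<Suc N]"

definition trunc_zeta :: "nat \<Rightarrow> nat list \<Rightarrow> real" where
  "trunc_zeta N k = qsym (recips N) k"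

lemma trunc_zeta_Suc:
  "trunc_zeta (Suc N) (k @ [a]) = trunc_zeta N (k @ [a]) + 1 / real (Suc N) ^ a * trunc_zeta N k"
proof -
  have "recips (Suc N) = recips N @ [1 / real (Suc N)]"
    by (simp add: recips_def)
  then show ?thesis by (simp add: trunc_zeta_def qsym_snoc power_one_over del: of_nat_Suc)
qed

lemma trunc_zeta_Nil [simp]: "trunc_zeta N [] = 1"
  by (simp add: trunc_zeta_def)

lemma trunc_zeta_0: "k \<noteq> [] \<Longrightarrow> trunc_zeta 0 k = 0"
  by (cases k) (auto simp: trunc_zeta_def recips_def)

lemma trunc_zeta_nonneg: "trunc_zeta N k \<ge> 0"
  unfolding trunc_zeta_def recips_def by (rule qsym_nonneg) auto

lemma trunc_zeta_one: "trunc_zeta N [1] = harm N"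
proof (induction N)
  case (Suc N)
  then show ?case using trunc_zeta_Suc[of N "[]" 1] by (simp add: harm_Suc inverse_eq_divide)
qed (simp add: trunc_zeta_0 harm_def)

lemma trunc_zeta_stuffle: "trunc_zeta N k * trunc_zeta N l = (\<Sum>p\<leftarrow>stuffle k l. trunc_zeta N p)"
  unfolding trunc_zeta_def by (rule qsym_stuffle)

text \<open>Lowering all exponents to 1 and dropping the ordering of the summation variables only
  enlarges the sum.\<close>

lemma trunc_zeta_le_harm_power:
  assumes "is_index k"
  shows "trunc_zeta N k \<le> harm N ^ length k"
  using assms
proof (induction k arbitrary: N rule: rev_induct)
  case Nil
  then show ?case by simp
next
  case (snoc a k)
  have k: "is_index k" and a: "a \<ge> 1" using snoc.prems by (auto simp: is_index_def)
  show ?case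
  proof (induction N)
    case 0
    then show ?case by (simp add: trunc_zeta_0 harm_nonneg)
  next
    case (Suc N)
    have "1 / real (Suc N) ^ a \<le> 1 / real (Suc N)"
      using a by (intro divide_left_mono) (auto intro: self_le_power)
    then have "1 / real (Suc N) ^ a * trunc_zeta N k \<le> 1 / real (Suc N) * harm N ^ length k"
      using snoc.IH[OF k] by (intro mult_mono) (auto simp: trunc_zeta_nonneg)
    then have "trunc_zeta (Suc N) (k @ [a]) \<le> harm N ^ length k * harm (Suc N)"
      using Suc by (simp add: trunc_zeta_Suc harm_Suc inverse_eq_divide algebra_simps)
    also have "\<dots> \<le> harm (Suc N) ^ length k * harm (Suc N)"
      by (intro mult_right_mono power_mono harm_mono harm_nonneg) auto
    finally show ?case by (simp add: mult.commute)
  qed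
qed

lemma harm_le_one_plus_ln: "n > 0 \<Longrightarrow> (harm n :: real) \<le> 1 + ln (real n)"
  using decseqD[OF decseq_harm_diff_ln, of 0 "n - 1"] by (simp add: harm_expand)

lemma summable_harm_power: "summable (\<lambda>n. harm n ^ m / real n ^ 2 :: real)"
proof -
  \<comment> \<open>Chosen so that \<open>e * m\<close> is at most 1/2: the power of
    \<open>harm n\<close> then costs at most n^(1/2), which leaves the summable n^(-3/2). The
    \<open>m + 1\<close> covers m = 0.\<close>
  define e :: real where "e = 1 / (2 * (m + 1))"
  have e: "e > 0" "e * m \<le> 1 / 2" by (auto simp: e_def field_simps)
  show ?thesis
  proof (rule summable_comparison_test_ev)
    show "summable (\<lambda>n. (1 + 1 / e) ^ m * real n powr (-3/2))"
      by (intro summable_mult) (subst summable_real_powr_iff, simp)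
    show "eventually (\<lambda>n. norm (harm n ^ m / real n ^ 2 :: real) \<le>
        (1 + 1 / e) ^ m * real n powr (-3/2)) sequentially"
      using eventually_gt_at_top[of 0]
    proof eventually_elim
      case (elim n)
      have n: "real n \<ge> 1" using elim by simp
      have "harm n \<le> 1 + ln (real n)" using harm_le_one_plus_ln elim by simp
      also have "\<dots> \<le> real n powr e + real n powr e / e"
        using ge_one_powr_ge_zero[OF n, of e] ln_powr_bound[OF n e(1)] e by simp
      finally have "harm n \<le> (1 + 1 / e) * real n powr e" by (simp add: algebra_simps)
      then have "harm n ^ m \<le> ((1 + 1 / e) * real n powr e) ^ m"
        by (intro power_mono harm_nonneg)
      also have "\<dots> = (1 + 1 / e) ^ m * real n powr (e * m)"
        using elim by (simp add: power_mult_distrib powr_powr[symmetric] powr_realpow)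
      also have "\<dots> \<le> (1 + 1 / e) ^ m * real n powr (1/2)"
        using e n by (intro mult_left_mono powr_mono) auto
      finally have "harm n ^ m / real n ^ 2 \<le> (1 + 1 / e) ^ m * real n powr (1/2) / real n powr 2"
        using elim by (simp add: divide_right_mono)
      also have "\<dots> = (1 + 1 / e) ^ m * (real n powr (1/2) / real n powr 2)" by simp
      also have "real n powr (1/2) / real n powr 2 = real n powr (-3/2)"
        by (subst powr_diff[symmetric]) simp
      finally show ?case by (simp add: harm_nonneg)
    qed
  qed
qed

section \<open>Truncated values as sums over increasing sequences, and their limit\<close>

definition cut_seqs :: "nat \<Rightarrow> nat \<Rightarrow> nat \<Rightarrow> nat list set" where
  "cut_seqs m M r = {n. length n = r \<and> (\<forall>j\<in>set n. m \<le> j \<and> j < M) \<and> sorted_wrt (<) n}"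

lemma finite_cut_seqs: "finite (cut_seqs m M r)"
proof (rule finite_subset)
  show "cut_seqs m M r \<subseteq> {n. set n \<subseteq> {m..<M} \<and> length n = r}"
    by (auto simp: cut_seqs_def)
qed (rule finite_lists_length_eq, simp)

lemma cut_seqs_Suc:
  assumes "m < M"
  shows "cut_seqs m M (Suc r) = cut_seqs (Suc m) M (Suc r) \<union> (#) m ` cut_seqs (Suc m) M r"
proof (intro equalityI subsetI)
  fix n assume n: "n \<in> cut_seqs m M (Suc r)"
  then obtain j n' where n': "n = j # n'" by (cases n) (auto simp: cut_seqs_def)
  show "n \<in> cut_seqs (Suc m) M (Suc r) \<union> (#) m ` cut_seqs (Suc m) M r"
  proof (cases "j = m")
    case True
    then have "n' \<in> cut_seqs (Suc m) M r" using n n' by (auto simp: cut_seqs_def)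
    then show ?thesis using n' True by blast
  next
    case False
    then have "\<forall>i\<in>set n. Suc m \<le> i"
      using n n' by (auto simp: cut_seqs_def Suc_le_eq)
    then show ?thesis using n by (auto simp: cut_seqs_def)
  qed
next
  fix n assume "n \<in> cut_seqs (Suc m) M (Suc r) \<union> (#) m ` cut_seqs (Suc m) M r"
  then show "n \<in> cut_seqs m M (Suc r)"
    using assms by (auto simp: cut_seqs_def Suc_le_eq less_imp_le)
qed

definition mzv_term :: "nat list \<Rightarrow> nat list \<Rightarrow> real" where
  "mzv_term k n = (\<Prod>i<length k. 1 / real (n ! i) ^ (k ! i))"

text \<open>Induction downwards on \<open>m\<close>, since \<open>qsym\<close> consumes its list
  from the front: a sequence either avoids \<open>m\<close> or starts with it.\<close>

lemma qsym_eq_sum: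
  assumes "m \<le> M"
  shows "qsym (map (\<lambda>n. 1 / real n) [m..<M]) k = (\<Sum>n\<in>cut_seqs m M (length k). mzv_term k n)"
  using assms
proof (induction m arbitrary: k rule: inc_induct)
  case base
  show ?case
  proof (cases k)
    case Nil
    then have "cut_seqs M M (length k) = {[]}" by (auto simp: cut_seqs_def)
    then show ?thesis using Nil by (simp add: mzv_term_def)
  next
    case (Cons a k')
    then have "n \<notin> cut_seqs M M (length k)" for n
      by (cases n) (auto simp: cut_seqs_def)
    then have "cut_seqs M M (length k) = {}" by blast
    then show ?thesis using Cons by simp
  qed
next
  case (step m)
  show ?case
  proof (cases k)
    case Nil
    then have "cut_seqs m M (length k) = {[]}" by (auto simp: cut_seqs_def)
    then show ?thesis using Nil by (simp add: mzv_term_def)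
  next
    case (Cons a k')
    have disj: "cut_seqs (Suc m) M (Suc (length k')) \<inter> (#) m ` cut_seqs (Suc m) M (length k') = {}"
      by (auto simp: cut_seqs_def)
    have "(\<Sum>n\<in>cut_seqs m M (length k). mzv_term k n) =
        (\<Sum>n\<in>cut_seqs (Suc m) M (length k). mzv_term k n) +
        (\<Sum>n\<in>(#) m ` cut_seqs (Suc m) M (length k'). mzv_term k n)"
      using step.hyps disj Cons by (simp add: cut_seqs_Suc sum.union_disjoint finite_cut_seqs)
    also have "(\<Sum>n\<in>(#) m ` cut_seqs (Suc m) M (length k'). mzv_term k n) =
        (\<Sum>n\<in>cut_seqs (Suc m) M (length k'). (1 / real m) ^ a * mzv_term k' n)"
      by (subst sum.reindex)
        (auto simp: mzv_term_def Cons o_def prod.lessThan_Suc_shift power_one_over simp del: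
          prod.lessThan_Suc)
    finally show ?thesis
      using step.hyps step.IH[of k] step.IH[of k'] Cons
      by (simp add: upt_conv_Cons sum_distrib_left)
  qed
qed

lemma trunc_zeta_eq_sum: "trunc_zeta N k = (\<Sum>n\<in>cut_seqs 1 (Suc N) (length k). mzv_term k n)"
  unfolding trunc_zeta_def recips_def by (rule qsym_eq_sum) simp

lemma mzv_term_nonneg: "mzv_term k n \<ge> 0"
  unfolding mzv_term_def by (intro prod_nonneg) auto

text \<open>\<open>mzv\<close> is an unordered sum. Its terms are nonnegative, so bounded
  truncations give summability, and the truncation sets eventually contain every finite set of
  sequences. The bound is established for admissible indices in
  \<open>trunc_zeta_minus_mzv_small\<close>.\<close>

lemma trunc_zeta_tendsto_mzv:
  assumes "\<And>N. trunc_zeta N k \<le> C"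
  shows "(\<lambda>N. trunc_zeta N k) \<longlonglongrightarrow> mzv k"
proof -
  define A where "A = {n. length n = length k \<and> (\<forall>j\<in>set n. j \<ge> (1::nat)) \<and> sorted_wrt (<) n}"
  have sub: "cut_seqs 1 (Suc N) (length k) \<subseteq> A" for N
    by (auto simp: cut_seqs_def A_def)
  have ex: "\<exists>N0. \<forall>N\<ge>N0. F \<subseteq> cut_seqs 1 (Suc N) (length k)" if F: "finite F" "F \<subseteq> A" for F
  proof (intro exI allI impI)
    \<comment> \<open>The threshold is the largest entry occurring in \<open>F\<close>; the inserted
      0 keeps \<open>Max\<close> meaningful when there is none.\<close>
    fix N assume N: "Max (insert 0 (\<Union>(set ` F))) \<le> N"
    have "j \<le> N" if "n \<in> F" "j \<in> set n" for n j
    proof (rule order.trans[OF Max_ge N])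
      show "finite (insert 0 (\<Union>(set ` F)))" using F(1) by simp
      show "j \<in> insert 0 (\<Union>(set ` F))" using that by blast
    qed
    then show "F \<subseteq> cut_seqs 1 (Suc N) (length k)"
      using F(2) unfolding A_def cut_seqs_def less_Suc_eq_le by blast
  qed
  have "mzv_term k summable_on A"
  proof (rule nonneg_bdd_above_summable_on)
    show "bdd_above (sum (mzv_term k) ` {F. F \<subseteq> A \<and> finite F})"
    proof (intro bdd_aboveI2)
      fix F assume "F \<in> {F. F \<subseteq> A \<and> finite F}"
      then obtain N where "\<forall>N'\<ge>N. F \<subseteq> cut_seqs 1 (Suc N') (length k)"
        using ex[of F] by auto
      then have "F \<subseteq> cut_seqs 1 (Suc N) (length k)" by simp
      then have "sum (mzv_term k) F \<le> trunc_zeta N k"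
        unfolding trunc_zeta_eq_sum by (intro sum_mono2 finite_cut_seqs mzv_term_nonneg)
      then show "sum (mzv_term k) F \<le> C" using assms[of N] by simp
    qed
  qed (rule mzv_term_nonneg)
  moreover have "mzv k = infsum (mzv_term k) A"
    unfolding mzv_def A_def mzv_term_def ..
  ultimately have "(mzv_term k has_sum mzv k) A"
    by (metis has_sum_infsum)
  then have "(sum (mzv_term k) \<longlongrightarrow> mzv k) (finite_subsets_at_top A)"
    by (simp add: has_sum_def)
  moreover have "filterlim (\<lambda>N. cut_seqs 1 (Suc N) (length k)) (finite_subsets_at_top A)
    sequentially"
    unfolding filterlim_finite_subsets_at_top eventually_sequentially
  proof (intro allI impI)
    fix F assume "finite F \<and> F \<subseteq> A"
    then obtain N0 where "\<forall>N\<ge>N0. F \<subseteq> cut_seqs 1 (Suc N) (length k)" using ex[of F] by auto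
    then show "\<exists>N0. \<forall>N\<ge>N0. finite (cut_seqs 1 (Suc N) (length k)) \<and>
        F \<subseteq> cut_seqs 1 (Suc N) (length k) \<and> cut_seqs 1 (Suc N) (length k) \<subseteq> A"
      by (intro exI[of _ N0]) (use sub finite_cut_seqs in auto)
  qed
  ultimately have "((\<lambda>N. sum (mzv_term k) (cut_seqs 1 (Suc N) (length k))) \<longlongrightarrow> mzv k) sequentially"
    by (rule filterlim_compose)
  then show ?thesis by (simp add: trunc_zeta_eq_sum)
qed

section \<open>Asymptotics and harmonic regularization\<close>

text \<open>Multiplying two asymptotic expansions multiplies errors by polynomials in
  \<open>harm N\<close>, and convergence to 0 alone would not survive that.\<close>

definition small :: "(nat \<Rightarrow> real) \<Rightarrow> bool" where
  "small e \<longleftrightarrow> (\<forall>j. (\<lambda>N. e N * harm N ^ j) \<longlonglongrightarrow> 0)"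

text \<open>The error is a tail of the series with terms \<open>s n\<close>, the contribution of the
  largest variable n + 1. As \<open>harm\<close> is increasing, \<open>harm N ^ j\<close> moves
  under the tail sum, where the convergent majorant \<open>h j\<close> absorbs it.\<close>

lemma trunc_zeta_minus_mzv_small:
  assumes "admissible k"
  shows "small (\<lambda>N. trunc_zeta N k - mzv k)"
proof (cases k rule: rev_cases)
  case Nil
  have "trunc_zeta N [] \<le> 1" for N by simp
  from trunc_zeta_tendsto_mzv[OF this] have "mzv [] = 1"
    by (simp add: LIMSEQ_const_iff)
  then show ?thesis using Nil by (simp add: small_def)
next
  case (snoc l a)
  have l: "is_index l" and a: "a \<ge> 2" using assms snoc by (auto simp: admissible_def is_index_def)
  define s where "s = (\<lambda>n. 1 / real (Suc n) ^ a * trunc_zeta n l)"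
  define h :: "nat \<Rightarrow> nat \<Rightarrow> real" where "h = (\<lambda>j n. harm (Suc n) ^ (length l +
    j) / real (Suc n) ^ 2)"
  have h: "summable (h j)" for j
    using summable_ignore_initial_segment[OF summable_harm_power[of "length l + j"], of 1]
    by (simp add: h_def)
  have s0: "s n \<ge> 0" for n by (simp add: s_def trunc_zeta_nonneg)
  have sh: "s n * harm (Suc n) ^ j \<le> h j n" for n j
  proof -
    have "1 / real (Suc n) ^ a \<le> 1 / real (Suc n) ^ 2"
      using a by (intro divide_left_mono power_increasing) auto
    moreover have "trunc_zeta n l \<le> harm (Suc n) ^ length l"
      using trunc_zeta_le_harm_power[OF l, of n]
        power_mono[OF harm_mono[of n "Suc n", where 'a = real] harm_nonneg, of "length l"] by simp
    ultimately have "s n \<le> 1 / real (Suc n) ^ 2 * harm (Suc n) ^ length l"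
      unfolding s_def by (intro mult_mono) (auto simp: trunc_zeta_nonneg harm_nonneg)
    from mult_right_mono[OF this, of "harm (Suc n) ^ j"] show ?thesis
      by (simp add: h_def power_add harm_nonneg)
  qed
  have s: "summable s"
    by (rule summable_comparison_test'[OF h[of 0], of 0]) (use s0 sh[of _ 0] in auto)
  have part: "trunc_zeta N k = sum s {..<N}" for N
    by (induction N) (simp_all add: snoc trunc_zeta_0 trunc_zeta_Suc s_def)
  have "trunc_zeta N k \<le> suminf s" for N
    unfolding part by (rule sum_le_suminf[OF s]) (auto simp: s0)
  from trunc_zeta_tendsto_mzv[OF this] have lim: "suminf s = mzv k"
    using summable_LIMSEQ[OF s] LIMSEQ_unique by (auto simp: part)
  show ?thesis
    unfolding small_def
  proof
    fix j
    have "(\<lambda>N. \<Sum>n. h j (n + N)) = (\<lambda>N. suminf (h j) - sum (h j) {..<N})"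
      using suminf_minus_initial_segment[OF h] by blast
    then have tail: "(\<lambda>N. \<Sum>n. h j (n + N)) \<longlonglongrightarrow> 0"
      using tendsto_diff[OF tendsto_const summable_LIMSEQ[OF h[of j]], of "suminf (h j)"] by simp
    show "(\<lambda>N. (trunc_zeta N k - mzv k) * harm N ^ j) \<longlonglongrightarrow> 0"
    proof (rule Lim_null_comparison[OF always_eventually tail], intro allI)
      fix N
      have sN: "summable (\<lambda>n. s (n + N))" using s by (rule summable_ignore_initial_segment)
      have "mzv k - trunc_zeta N k = (\<Sum>n. s (n + N))"
        using suminf_minus_initial_segment[OF s, of N] by (simp add: lim part)
      then have "norm ((trunc_zeta N k - mzv k) * harm N ^ j) = (\<Sum>n. s (n + N)) * harm N ^ j"
        using suminf_nonneg[OF sN] s0 by (simp add: abs_mult harm_nonneg abs_minus_commute)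
      also have "\<dots> = (\<Sum>n. s (n + N) * harm N ^ j)"
        using sN by (rule suminf_mult2)
      also have "\<dots> \<le> (\<Sum>n. h j (n + N))"
      proof (rule suminf_le)
        fix n
        have "s (n + N) * harm N ^ j \<le> s (n + N) * harm (Suc (n + N)) ^ j"
          by (intro mult_left_mono power_mono harm_mono harm_nonneg s0) auto
        then show "s (n + N) * harm N ^ j \<le> h j (n + N)" using sh[of "n + N" j] by simp
      qed (use sN h in \<open>auto intro: summable_mult2 summable_ignore_initial_segment\<close>)
      finally show "norm ((trunc_zeta N k - mzv k) * harm N ^ j) \<le> (\<Sum>n. h j (n + N))" .
    qed
  qed
qed

lemma small_tendsto: "small e \<Longrightarrow> e \<longlonglongrightarrow> 0"
  unfolding small_def by (drule spec[of _ 0]) simp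

lemma small_zero: "small (\<lambda>_. 0)"
  by (simp add: small_def)

lemma small_add: "small e \<Longrightarrow> small e' \<Longrightarrow> small (\<lambda>N. e N + e' N)"
  unfolding small_def distrib_right by (auto intro: tendsto_add_zero)

lemma small_cmult: "small e \<Longrightarrow> small (\<lambda>N. c * e N)"
  unfolding small_def mult.assoc by (auto intro: tendsto_mult_right_zero)

lemma small_diff: "small e \<Longrightarrow> small e' \<Longrightarrow> small (\<lambda>N. e N - e' N)"
  using small_add[of e "\<lambda>N. -1 * e' N"] small_cmult[of e' "-1"] by simp

lemma small_mult: "small e \<Longrightarrow> small e' \<Longrightarrow> small (\<lambda>N. e N * e' N)"
  unfolding small_def
proof
  fix j assume e: "\<forall>j. (\<lambda>N. e N * harm N ^ j) \<longlonglongrightarrow> 0" and "\<forall>j. (\<lambda>N. e' N * harm N ^ j) \<longlonglongrightarrow> 0"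
  then have "e' \<longlonglongrightarrow> 0" by (metis small_def small_tendsto)
  from tendsto_mult[OF this e[rule_format, of j]]
  show "(\<lambda>N. e N * e' N * harm N ^ j) \<longlonglongrightarrow> 0" by (simp add: ac_simps)
qed

lemma small_mult_harm: "small e \<Longrightarrow> small (\<lambda>N. e N * harm N)"
  unfolding small_def
proof
  fix j assume "\<forall>j. (\<lambda>N. e N * harm N ^ j) \<longlonglongrightarrow> 0"
  then show "(\<lambda>N. e N * harm N * harm N ^ j) \<longlonglongrightarrow> 0"
    by (drule_tac spec[of _ "Suc j"]) (simp add: mult.assoc)
qed

lemma small_mult_poly: "small e \<Longrightarrow> small (\<lambda>N. e N * poly P (harm N))"
proof (induction P arbitrary: e)
  case 0
  then show ?case by (simp add: small_zero)
next
  case (pCons a P)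
  have "small (\<lambda>N. a * e N + e N * harm N * poly P (harm N))"
    by (intro small_add small_cmult pCons.IH small_mult_harm pCons.prems)
  then show ?case by (simp add: algebra_simps)
qed

text \<open>Subtracting the constant coefficient and dividing by \<open>harm N\<close>, which tends
  to infinity, passes from \<open>pCons a Q\<close> to \<open>Q\<close>. This makes the polynomial
  of an asymptotic expansion unique, hence also its constant term.\<close>

lemma poly_harm_tendsto_0_imp:
  assumes "(\<lambda>N. poly Q (harm N :: real)) \<longlonglongrightarrow> 0"
  shows "Q = 0"
  using assms
proof (induction Q)
  case (pCons a Q)
  have h: "filterlim (\<lambda>N. harm N :: real) at_infinity sequentially"
    using harm_at_top by (rule filterlim_at_top_imp_at_infinity)
  have "(\<lambda>N. (poly (pCons a Q) (harm N) - a) / harm N) \<longlonglongrightarrow> 0"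
    by (rule tendsto_divide_0[OF tendsto_diff[OF pCons.prems tendsto_const] h])
  moreover have "eventually (\<lambda>N. (poly (pCons a Q) (harm N) - a) / harm N =
    poly Q (harm N)) sequentially"
    using eventually_gt_at_top[of 0]
  proof eventually_elim
    case (elim N)
    then have "(harm N :: real) \<noteq> 0" by (metis harm_pos less_irrefl)
    then show ?case by simp
  qed
  ultimately have "(\<lambda>N. poly Q (harm N)) \<longlonglongrightarrow> 0"
    by (rule Lim_transform_eventually)
  then have Q: "Q = 0" by (rule pCons.IH)
  with pCons.prems have "a = 0" by (simp add: LIMSEQ_const_iff)
  with Q show ?case by simp
qed simp

text \<open>The harmonic number is \<open>\<zeta>(1)\<close> truncated at \<open>N\<close>, so \<open>c\<close> is what \<open>s\<close> becomes under the
  harmonic regularization \<open>\<zeta>(1) = 0\<close>.\<close>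

definition reg :: "(nat \<Rightarrow> real) \<Rightarrow> real \<Rightarrow> bool" where
  "reg s c \<longleftrightarrow> (\<exists>P. poly P 0 = c \<and> small (\<lambda>N. s N - poly P (harm N)))"

lemma reg_unique:
  assumes "reg s c" "reg s d"
  shows "c = d"
proof -
  obtain P Q where P: "poly P 0 = c" "small (\<lambda>N. s N - poly P (harm N))"
    and Q: "poly Q 0 = d" "small (\<lambda>N. s N - poly Q (harm N))"
    using assms by (auto simp: reg_def)
  have "(\<lambda>N. poly (Q - P) (harm N)) \<longlonglongrightarrow> 0"
    using small_tendsto[OF small_diff[OF P(2) Q(2)]] by simp
  then have "Q - P = 0" by (rule poly_harm_tendsto_0_imp)
  then show ?thesis using P Q by simp
qed

lemma reg_const: "reg (\<lambda>_. c) c"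
  unfolding reg_def by (rule exI[of _ "[:c:]"]) (simp add: small_zero)

lemma reg_harm: "reg harm 0"
  unfolding reg_def by (rule exI[of _ "[:0, 1:]"]) (simp add: small_zero)

lemma reg_small: "small (\<lambda>N. s N - c) \<Longrightarrow> reg s c"
  unfolding reg_def by (rule exI[of _ "[:c:]"]) simp

lemma reg_add: "reg s c \<Longrightarrow> reg s' c' \<Longrightarrow> reg (\<lambda>N. s N + s' N) (c + c')"
proof -
  assume "reg s c" "reg s' c'"
  then obtain P Q where P: "poly P 0 = c" "small (\<lambda>N. s N - poly P (harm N))"
    and Q: "poly Q 0 = c'" "small (\<lambda>N. s' N - poly Q (harm N))"
    by (auto simp: reg_def)
  show ?thesis unfolding reg_def
    by (rule exI[of _ "P + Q"]) (use P Q small_add[OF P(2) Q(2)] in \<open>simp add: algebra_simps\<close>)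
qed

text \<open>With errors e, e' and polynomials P, Q, the error of the product is e e' + e Q + e'
  P.\<close>

lemma reg_mult: "reg s c \<Longrightarrow> reg s' c' \<Longrightarrow> reg (\<lambda>N. s N * s' N) (c * c')"
proof -
  assume "reg s c" "reg s' c'"
  then obtain P Q where P: "poly P 0 = c" "small (\<lambda>N. s N - poly P (harm N))"
    and Q: "poly Q 0 = c'" "small (\<lambda>N. s' N - poly Q (harm N))"
    by (auto simp: reg_def)
  have "small (\<lambda>N. (s N - poly P (harm N)) * (s' N - poly Q (harm N)) +
      ((s N - poly P (harm N)) * poly Q (harm N) + (s' N - poly Q (harm N)) * poly P (harm N)))"
    by (intro small_add small_mult small_mult_poly P Q)
  also have "(\<lambda>N. (s N - poly P (harm N)) * (s' N - poly Q (harm N)) +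
      ((s N - poly P (harm N)) * poly Q (harm N) + (s' N - poly Q (harm N)) * poly P (harm N)))
      = (\<lambda>N. s N * s' N - poly (P * Q) (harm N))"
    by (simp add: algebra_simps)
  finally show ?thesis using P Q unfolding reg_def by (intro exI[of _ "P * Q"]) simp
qed

lemma reg_cmult: "reg s c \<Longrightarrow> reg (\<lambda>N. a * s N) (a * c)"
  by (rule reg_mult[OF reg_const])

lemma reg_diff: "reg s c \<Longrightarrow> reg s' c' \<Longrightarrow> reg (\<lambda>N. s N - s' N) (c - c')"
  using reg_add[of s c "\<lambda>N. -1 * s' N" "-1 * c'"] reg_cmult[of s' c' "-1"] by simp

lemma reg_sum_list:
  "(\<And>p. p \<in> set ps \<Longrightarrow> reg (s p) (c p)) \<Longrightarrow> reg (\<lambda>N. \<Sum>p\<leftarrow>ps. s p N) (\<Sum>p\<leftarrow>ps. c p)"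
  by (induction ps) (auto intro: reg_add reg_const)

section \<open>Trailing ones: reduction of all indices to admissible ones\<close>

definition trail :: "nat list \<Rightarrow> nat" where
  "trail k = length (takeWhile (\<lambda>a. a = 1) (rev k))"

lemma trail_snoc: "trail (k @ [a]) = (if a = 1 then Suc (trail k) else 0)"
  by (simp add: trail_def)

lemma trail_Nil [simp]: "trail [] = 0"
  by (simp add: trail_def)

lemma trail_Cons: "\<exists>b\<in>set k. b \<noteq> 1 \<Longrightarrow> trail (a # k) = trail k"
  by (auto simp: trail_def intro!: arg_cong[of _ _ length] takeWhile_append1)

lemma trail_Cons_ones:
  "\<forall>b\<in>set k. b = 1 \<Longrightarrow> trail (a # k) = (if a = 1 then Suc (length k) else length k)"
  unfolding trail_def rev.simps by (subst takeWhile_append2) auto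

lemma trail_ones: "\<forall>b\<in>set k. b = 1 \<Longrightarrow> trail k = length k"
  by (simp add: trail_def takeWhile_eq_all_conv[THEN iffD2])

lemma admissible_iff_trail: "is_index k \<Longrightarrow> admissible k \<longleftrightarrow> trail k = 0"
  by (cases k rule: rev_cases) (auto simp: admissible_def trail_snoc is_index_def)

text \<open>A 1 inserted anywhere into the final block of ones yields \<open>k @ [1]\<close>, whence
  the multiplicity \<open>Suc (trail k)\<close>; every other term has no more trailing ones than
  \<open>k\<close>. Solving for \<open>k @ [1]\<close> drives the inductions for existence and
  uniqueness of the regularization and for its values in \<open>mzv_space\<close>.\<close>

lemma stuffle_one:
  assumes "is_index k"
  obtains ps where "\<forall>p\<in>set ps. is_index p \<and> trail p \<le> trail k"
    and "\<And>f :: nat list \<Rightarrow> real.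
      (\<Sum>p\<leftarrow>stuffle [1] k. f p) = real (Suc (trail k)) * f (k @ [1]) + (\<Sum>p\<leftarrow>ps. f p)"
proof -
  \<comment> \<open>The additional entry other than 1 makes \<open>trail\<close> insensitive to a
    prefixed letter, which the induction step needs.\<close>
  have "\<exists>ps. (\<forall>p\<in>set ps. is_index p \<and> trail p \<le> trail k \<and> (\<exists>b\<in>set p. b \<noteq> 1)) \<and>
    (\<forall>f :: nat list \<Rightarrow> real.
      (\<Sum>p\<leftarrow>stuffle [1] k. f p) = real (Suc (trail k)) * f (k @ [1]) + (\<Sum>p\<leftarrow>ps. f p))"
    using assms
  proof (induction k)
    case Nil
    show ?case by (rule exI[of _ "[]"]) simp
  next
    case (Cons b l)
    have l: "is_index l" and b: "b \<ge> 1" using Cons.prems by (auto simp: is_index_def)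
    obtain ps where ps: "\<And>p. p \<in> set ps \<Longrightarrow> is_index p \<and> trail p \<le> trail l \<and> (\<exists>b\<in>set p. b \<noteq> 1)"
      and f: "\<And>f :: nat list \<Rightarrow> real.
        (\<Sum>p\<leftarrow>stuffle [1] l. f p) = real (Suc (trail l)) * f (l @ [1]) + (\<Sum>p\<leftarrow>ps. f p)"
      using Cons.IH[OF l] by blast
    have g: "(\<Sum>p\<leftarrow>stuffle [1] (b # l). f p) = f (1 # b # l) + f (Suc b # l) +
        real (Suc (trail l)) * f (b # l @ [1]) + (\<Sum>p\<leftarrow>map ((#) b) ps. f p)" for f :: "nat list \<Rightarrow>
          real"
      using f[of "\<lambda>p. f (b # p)"] by (simp add: o_def)
    \<comment> \<open>If all entries are 1, then \<open>1 # b # l\<close> equals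
      \<open>b # l @ [1]\<close> and raises the multiplicity by one; otherwise it joins the
      remaining terms.\<close>
    show ?case
    proof (cases "\<forall>c\<in>set (b # l). c = 1")
      case True
      then have ones: "b = 1" "\<forall>c\<in>set l. c = 1" by auto
      have rep: "l = replicate (length l) 1"
        using ones(2) by (simp add: replicate_length_same)
      have e: "b # l @ [1] = 1 # b # l" "(b # l) @ [1] = 1 # b # l"
        using ones(1) by (subst (1 2) rep, simp add: replicate_append_same)+
      have tr: "trail (b # l) = Suc (trail l)" "trail (Suc b # l) = trail l"
        using ones by (simp_all add: trail_Cons_ones trail_ones)
      have "(\<Sum>p\<leftarrow>stuffle [1] (b # l). f p) = real (Suc (trail (b # l))) * f ((b # l) @ [1]) +
          (\<Sum>p\<leftarrow>(Suc b # l) # map ((#) b) ps. f p)" for f :: "nat list \<Rightarrow> real"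
        unfolding g e tr by (simp add: algebra_simps)
      moreover have "trail (b # p) \<le> Suc (trail l)" if "p \<in> set ps" for p
        using ps[OF that] by (simp add: trail_Cons)
      ultimately show ?thesis
        using ps l b tr
        by (intro exI[of _ "(Suc b # l) # map ((#) b) ps"]) (auto simp: is_index_def)
    next
      case False
      have t: "trail (b # l) = trail l"
      proof (cases "\<forall>c\<in>set l. c = 1")
        case True
        then show ?thesis using False by (auto simp: trail_Cons_ones trail_ones)
      qed (simp add: trail_Cons)
      have t1: "trail (1 # b # l) = trail l"
        using False t by (simp add: trail_Cons)
      have t2: "trail (Suc b # l) = trail l"
        using b by (cases "\<forall>c\<in>set l. c = 1") (simp_all add: trail_Cons trail_Cons_ones trail_ones)
      have "(\<Sum>p\<leftarrow>stuffle [1] (b # l). f p) = real (Suc (trail (b # l))) * f ((b # l) @ [1]) +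
          (\<Sum>p\<leftarrow>(1 # b # l) # (Suc b # l) # map ((#) b) ps. f p)" for f :: "nat list \<Rightarrow> real"
        unfolding g t by simp
      moreover have "\<exists>c\<in>set (b # l). c \<noteq> 1" using False by blast
      ultimately show ?thesis
        using ps l b t t1 t2
        by (intro exI[of _ "(1 # b # l) # (Suc b # l) # map ((#) b) ps"])
          (auto simp: is_index_def trail_Cons)
    qed
  qed
  then show ?thesis using that by blast
qed

lemma nonadmissible_cases:
  assumes "is_index k" "trail k = Suc m"
  obtains l where "k = l @ [1]" "is_index l" "trail l = m"
  using assms by (cases k rule: rev_cases) (auto simp: trail_snoc is_index_def split: if_splits)

lemma is_index_one: "is_index [1]"
  by (simp add: is_index_def)

text \<open>The stuffle relation, solved for \<open>l @ [1]\<close>, leaves \<open>harm N\<close>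
  times the value at \<open>l\<close> and further values, all with fewer trailing ones.\<close>

lemma reg_trunc_zeta_exists: "is_index k \<Longrightarrow> \<exists>c. reg (\<lambda>N. trunc_zeta N k) c"
proof (induction "trail k" arbitrary: k rule: less_induct)
  case less
  show ?case
  proof (cases "trail k")
    case 0
    then have "admissible k" using less.prems by (simp add: admissible_iff_trail)
    then show ?thesis using reg_small[OF trunc_zeta_minus_mzv_small] by blast
  next
    case (Suc m)
    then obtain l where l: "k = l @ [1]" "is_index l" "trail l = m"
      using less.prems nonadmissible_cases by metis
    obtain ps where ps: "\<forall>p\<in>set ps. is_index p \<and> trail p \<le> trail l"
      and f: "\<And>f :: nat list \<Rightarrow> real.
        (\<Sum>p\<leftarrow>stuffle [1] l. f p) = real (Suc (trail l)) * f (l @ [1]) + (\<Sum>p\<leftarrow>ps. f p)"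
      using stuffle_one[OF l(2)] by blast
    have "\<exists>c. reg (\<lambda>N. trunc_zeta N p) c" if "is_index p" "trail p \<le> m" for p
      using less.hyps[of p] that Suc by simp
    then obtain c where c: "\<And>p. is_index p \<Longrightarrow> trail p \<le> m \<Longrightarrow> reg (\<lambda>N. trunc_zeta N p) (c p)"
      by metis
    have "trunc_zeta N k = 1 / real (Suc m) * (harm N * trunc_zeta N l -
      (\<Sum>p\<leftarrow>ps. trunc_zeta N p))" for N
      using f[of "trunc_zeta N"] trunc_zeta_stuffle[of N "[1]" l] l(1,3) unfolding trunc_zeta_one
      by (simp add: field_simps del: of_nat_Suc)
    moreover have "reg (\<lambda>N. 1 / real (Suc m) * (harm N * trunc_zeta N l - (\<Sum>p\<leftarrow>ps. trunc_zeta N p)))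
        (1 / real (Suc m) * (0 * c l - (\<Sum>p\<leftarrow>ps. c p)))"
      using ps l by (intro reg_cmult reg_diff reg_mult reg_harm reg_sum_list c) auto
    ultimately show ?thesis by auto
  qed
qed

lemma is_index_Cons: "is_index (a # k) \<longleftrightarrow> a \<ge> 1 \<and> is_index k"
  by (simp add: is_index_def)

lemma is_index_stuffle: "is_index k \<Longrightarrow> is_index l \<Longrightarrow> set (stuffle k l) \<subseteq> Collect is_index"
proof (induction k l rule: stuffle.induct)
  case (3 a k b l)
  have kl: "is_index k" "is_index l" "a \<ge> 1" "b \<ge> 1" "is_index (a # k)" "is_index (b # l)"
    using 3(4,5) by (simp_all add: is_index_Cons)
  show ?case
    using 3(1)[OF kl(1,6)] 3(2)[OF kl(5,2)] 3(3)[OF kl(1,2)] kl(3,4)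
    by (auto simp: is_index_Cons)
qed simp_all

text \<open>Once the value at \<open>[1]\<close> is 0, the same solved relation determines the value
  at \<open>l @ [1]\<close> from values with fewer trailing ones.\<close>

lemma harmonic_regularization_unique:
  assumes f: "is_harmonic_regularization f" and g: "is_harmonic_regularization g"
  shows "f = g"
proof
  fix k
  have "f k = g k" if "is_index k"
    using that
  proof (induction "trail k" arbitrary: k rule: less_induct)
    case less
    show ?case
    proof (cases "trail k")
      case 0
      then have "admissible k" using less.prems by (simp add: admissible_iff_trail)
      then show ?thesis using f g by (simp add: is_harmonic_regularization_def)
    next
      case (Suc m)
      then obtain l where l: "k = l @ [1]" "is_index l" "trail l = m"
        using less.prems nonadmissible_cases by metis
      obtain ps where ps: "\<forall>p\<in>set ps. is_index p \<and> trail p \<le> trail l"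
        and st: "\<And>f :: nat list \<Rightarrow> real.
          (\<Sum>p\<leftarrow>stuffle [1] l. f p) = real (Suc (trail l)) * f (l @ [1]) + (\<Sum>p\<leftarrow>ps. f p)"
        using stuffle_one[OF l(2)] by blast
      have "h [1] * h l = (\<Sum>p\<leftarrow>stuffle [1] l. h p)" "h [1] =
        0" if "is_harmonic_regularization h" for h
        using that l(2) is_index_one unfolding is_harmonic_regularization_def by blast+
      then have 0: "real (Suc m) * h k + (\<Sum>p\<leftarrow>ps. h p) = 0" if "is_harmonic_regularization h" for h
        using that st[of h] l by (metis mult_zero_left)
      have "(\<Sum>p\<leftarrow>ps. f p) = (\<Sum>p\<leftarrow>ps. g p)"
        using ps l Suc by (intro arg_cong[of _ _ sum_list] map_cong refl less.hyps) auto
      then have "real (Suc m) * f k = real (Suc m) * g k"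
        using 0[OF f] 0[OF g] by linarith
      then show ?thesis by (simp del: of_nat_Suc)
    qed
  qed
  then show "f k = g k" using f g by (cases "is_index k") (auto simp:
    is_harmonic_regularization_def)
qed

text \<open>\<open>zeta\<close> is a definite description: existence comes from the constant terms
  of the truncations, uniqueness from the preceding induction.\<close>

lemma zeta_regularization: "is_harmonic_regularization zeta"
  and reg_trunc_zeta: "is_index k \<Longrightarrow> reg (\<lambda>N. trunc_zeta N k) (zeta k)"
proof -
  define f where "f = (\<lambda>k. if is_index k then THE c. reg (\<lambda>N. trunc_zeta N k) c else 0)"
  have reg: "reg (\<lambda>N. trunc_zeta N k) (f k)" if "is_index k" for k
    using theI'[of "reg (\<lambda>N. trunc_zeta N k)"] reg_trunc_zeta_exists[OF that] reg_unique that
    by (auto simp: f_def)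
  have f: "is_harmonic_regularization f"
    unfolding is_harmonic_regularization_def
  proof (intro conjI allI impI)
    fix k assume k: "admissible k"
    then show "f k = mzv k"
      using reg_unique[OF reg reg_small[OF trunc_zeta_minus_mzv_small[OF k]]] by
        (simp add: admissible_def)
  next
    show "f [1] = 0"
      using reg_unique[OF reg[OF is_index_one]] reg_harm by (simp only: trunc_zeta_one)
  next
    fix k l assume kl: "is_index k \<and> is_index l"
    have "reg (\<lambda>N. \<Sum>p\<leftarrow>stuffle k l. trunc_zeta N p) (\<Sum>p\<leftarrow>stuffle k l. f p)"
      using kl by (intro reg_sum_list reg) (use is_index_stuffle in auto)
    moreover have "reg (\<lambda>N. trunc_zeta N k * trunc_zeta N l) (f k * f l)"
      using kl by (intro reg_mult reg) auto
    ultimately show "f k * f l = (\<Sum>p\<leftarrow>stuffle k l. f p)"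
      unfolding trunc_zeta_stuffle by (rule reg_unique[rotated])
  qed (simp add: f_def)
  have "zeta = f"
    unfolding zeta_def by (rule the_equality[where P = is_harmonic_regularization and a =
      f, OF f]) (rule harmonic_regularization_unique[OF _ f])
  then show "is_harmonic_regularization zeta" "is_index k \<Longrightarrow> reg (\<lambda>N. trunc_zeta N k) (zeta k)"
    using f reg by auto
qed

lemma zeta_one: "zeta [1] = 0"
  using zeta_regularization by (simp add: is_harmonic_regularization_def)

lemma zeta_Nil: "zeta [] = 1"
  using reg_unique[OF reg_trunc_zeta[of "[]"]] reg_const[of 1] by (simp add: is_index_def)

section \<open>The rational span of multiple zeta values as a subring\<close>

lemma rat_module: "Modules.module (\<lambda>(q::rat) (r::real). of_rat q * r)"
  by unfold_locales (simp_all add: algebra_simps of_rat_add of_rat_mult)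

lemma mzv_space_add: "x \<in> mzv_space \<Longrightarrow> y \<in> mzv_space \<Longrightarrow> x + y \<in> mzv_space"
  unfolding mzv_space_def by (rule module.span_add[OF rat_module])

lemma mzv_space_zero: "0 \<in> mzv_space"
  unfolding mzv_space_def by (rule module.span_zero[OF rat_module])

lemma mzv_space_scale: "x \<in> mzv_space \<Longrightarrow> of_rat q * x \<in> mzv_space"
  unfolding mzv_space_def by (rule module.span_scale[OF rat_module])

lemma mzv_space_uminus: "x \<in> mzv_space \<Longrightarrow> - x \<in> mzv_space"
  using mzv_space_scale[of x "-1"] by simp

lemma mzv_space_sum_list: "(\<And>x. x \<in> set xs \<Longrightarrow> x \<in> mzv_space) \<Longrightarrow> sum_list xs \<in> mzv_space"
  by (induction xs) (auto intro: mzv_space_zero mzv_space_add)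

text \<open>With zeta(1) = 0 the solved stuffle relation is a rational linear combination, its one
  denominator being \<open>Suc m\<close>.\<close>

lemma zeta_in_mzv_space: "zeta k \<in> mzv_space"
proof (cases "is_index k")
  case False
  then show ?thesis
    using zeta_regularization mzv_space_zero by (simp add: is_harmonic_regularization_def)
next
  case True
  then show ?thesis
  proof (induction "trail k" arbitrary: k rule: less_induct)
    case less
    show ?case
    proof (cases "trail k")
      case 0
      then have "admissible k" using less.prems by (simp add: admissible_iff_trail)
      then have "zeta k \<in> {mzv k | k. admissible k}"
        using zeta_regularization unfolding is_harmonic_regularization_def by blast
      then show ?thesis
        unfolding mzv_space_def by (rule module.span_base[OF rat_module])
    next
      case (Suc m)
      then obtain l where l: "k = l @ [1]" "is_index l" "trail l = m"
        using less.prems nonadmissible_cases by metis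
      obtain ps where ps: "\<forall>p\<in>set ps. is_index p \<and> trail p \<le> trail l"
        and st: "\<And>f :: nat list \<Rightarrow> real.
          (\<Sum>p\<leftarrow>stuffle [1] l. f p) = real (Suc (trail l)) * f (l @ [1]) + (\<Sum>p\<leftarrow>ps. f p)"
        using stuffle_one[OF l(2)] by blast
      have "zeta [1] * zeta l = (\<Sum>p\<leftarrow>stuffle [1] l. zeta p)"
        using zeta_regularization l(2) is_index_one unfolding is_harmonic_regularization_def by
          blast
      then have "real (Suc m) * zeta k + (\<Sum>p\<leftarrow>ps. zeta p) = 0"
        using st[of zeta] l zeta_one by (metis mult_zero_left)
      then have "zeta k = of_rat (- 1 / of_nat (Suc m)) * (\<Sum>p\<leftarrow>ps. zeta p)"
        by (simp add: of_rat_divide of_rat_minus field_simps del: of_nat_Suc)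
      moreover have "(\<Sum>p\<leftarrow>ps. zeta p) \<in> mzv_space"
        using ps l Suc by (intro mzv_space_sum_list) (auto intro!: less.hyps)
      ultimately show ?thesis using mzv_space_scale by metis
    qed
  qed
qed

lemma mzv_space_mult:
  assumes "x \<in> mzv_space" "y \<in> mzv_space"
  shows "x * y \<in> mzv_space"
proof -
  \<comment> \<open>The terms of the stuffle product are covered by
    \<open>zeta_in_mzv_space\<close>, which speaks of all lists.\<close>
  have gen: "mzv k * mzv l \<in> mzv_space" if "admissible k" "admissible l" for k l
  proof -
    have "mzv k * mzv l = (\<Sum>p\<leftarrow>stuffle k l. zeta p)"
      using zeta_regularization that
      by (metis admissible_def is_harmonic_regularization_def)
    then show ?thesis using zeta_in_mzv_space by (auto intro!: mzv_space_sum_list)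
  qed
  have left: "mzv k * y \<in> mzv_space" if k: "admissible k" for k
    \<comment> \<open>Instantiated at \<open>y\<close>, the equation unfolds the span only in the
      premise; the goal keeps \<open>mzv_space\<close>.\<close>
    using assms(2) unfolding mzv_space_def[THEN arg_cong, of "\<lambda>S. y \<in> S"]
  proof (induction rule: module.span_induct_alt[OF rat_module, consumes 1])
    case 1
    show ?case using mzv_space_zero by simp
  next
    case (2 c x y)
    then have "mzv k * x \<in> mzv_space" using gen k by auto
    then show ?case
      using mzv_space_add[OF mzv_space_scale[of "mzv k * x" c] 2(2)] by (simp add: algebra_simps)
  qed
  show ?thesis
    using assms(1) unfolding mzv_space_def[THEN arg_cong, of "\<lambda>S. x \<in> S"]
  proof (induction rule: module.span_induct_alt[OF rat_module, consumes 1])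
    case 1
    show ?case using mzv_space_zero by simp
  next
    case (2 c u v)
    then have "u * y \<in> mzv_space" using left by auto
    then show ?case
      using mzv_space_add[OF mzv_space_scale[of "u * y" c] 2(2)] by (simp add: algebra_simps)
  qed
qed

lemma mzv_space_rat: "of_rat q \<in> mzv_space"
proof -
  show ?thesis using zeta_Nil mzv_space_scale[OF zeta_in_mzv_space[of "[]"], of q] by simp
qed

section \<open>Recursions for the truncated generating series\<close>

definition wt_indices :: "nat \<Rightarrow> nat list set" where
  "wt_indices d = {k. is_index k \<and> wt k = d}"

lemma finite_wt_indices: "finite (wt_indices d)"
proof (rule finite_subset)
  show "wt_indices d \<subseteq> {k. set k \<subseteq> {..d} \<and> length k \<le> d}"
  proof
    fix k assume k: "k \<in> wt_indices d"
    have "length k \<le> sum_list k" if "is_index k" for k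
      using that by (induction k) (auto simp: is_index_Cons)
    then show "k \<in> {k. set k \<subseteq> {..d} \<and> length k \<le> d}"
      using k by (auto simp: wt_indices_def wt_def member_le_sum_list)
  qed
qed (rule finite_lists_length_le, simp)

lemma wt_indices_0: "wt_indices 0 = {[]}"
proof -
  have "k = []" if "k \<in> wt_indices 0" for k
    using that by (cases k) (auto simp: wt_indices_def wt_def is_index_Cons)
  moreover have "[] \<in> wt_indices 0" by (simp add: wt_indices_def wt_def is_index_def)
  ultimately show ?thesis by blast
qed

lemma wt_indices_pos:
  "d > 0 \<Longrightarrow> wt_indices d = (\<lambda>(a, k). a # k) ` (SIGMA a:{1..d}. wt_indices (d - a))"
proof (intro equalityI subsetI)
  fix k assume "d > 0" "k \<in> wt_indices d"
  then obtain a l where k: "k = a # l" by (cases k) (auto simp: wt_indices_def wt_def)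
  then have "(a, l) \<in> (SIGMA a:{1..d}. wt_indices (d - a))"
    using \<open>k \<in> wt_indices d\<close> by (auto simp: wt_indices_def wt_def is_index_Cons)
  then show "k \<in> (\<lambda>(a, k). a # k) ` (SIGMA a:{1..d}. wt_indices (d - a))"
    unfolding k by force
qed (auto simp: wt_indices_def wt_def is_index_Cons)

text \<open>The power series variable records the weight; this keeps all sums finite.\<close>

definition wt_gf :: "(nat list \<Rightarrow> 'a::comm_ring_1) \<Rightarrow> 'a fps" where
  "wt_gf F = Abs_fps (\<lambda>d. \<Sum>k\<in>wt_indices d. F k)"

lemma wt_gf_cong: "(\<And>k. is_index k \<Longrightarrow> F k = G k) \<Longrightarrow> wt_gf F = wt_gf G"
  by (auto simp: wt_gf_def fps_eq_iff wt_indices_def intro!: sum.cong)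

lemma wt_gf_add: "wt_gf (\<lambda>k. F k + G k) = wt_gf F + wt_gf G"
  by (simp add: wt_gf_def fps_eq_iff sum.distrib)

lemma wt_gf_cmult: "wt_gf (\<lambda>k. c * F k) = fps_const c * wt_gf F"
  by (simp add: wt_gf_def fps_eq_iff sum_distrib_left)

lemma wt_gf_Nil: "(\<And>k. k \<noteq> [] \<Longrightarrow> F k = 0) \<Longrightarrow> wt_gf F = fps_const (F [])"
proof (rule fps_ext)
  fix d assume F: "\<And>k. k \<noteq> [] \<Longrightarrow> F k = 0"
  have "(\<Sum>k\<in>wt_indices d. F k) = 0" if d: "d > 0"
  proof (intro sum.neutral ballI F)
    show "k \<noteq> []" if "k \<in> wt_indices d" for k
      using that d by (cases k) (auto simp: wt_indices_def wt_def)
  qed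
  then show "fps_nth (wt_gf F) d = fps_nth (fps_const (F [])) d"
    by (cases "d = 0") (auto simp: wt_gf_def wt_indices_0)
qed

definition letter_fps :: "(nat \<Rightarrow> 'a::comm_ring_1) \<Rightarrow> 'a fps" where
  "letter_fps \<phi> = Abs_fps (\<lambda>a. if a = 0 then 0 else \<phi> a)"

text \<open>Prefixing a letter is a convolution in the weight. Through this, recursions on indices
  become algebraic equations between generating series; the empty index supplies the
  constant.\<close>

lemma wt_gf_Cons:
  assumes "\<And>a k. a \<ge> 1 \<Longrightarrow> is_index k \<Longrightarrow> F (a # k) = \<phi> a * G k"
  shows "wt_gf F = fps_const (F []) + letter_fps \<phi> * wt_gf G"
proof (rule fps_ext)
  fix d
  show "fps_nth (wt_gf F) d = fps_nth (fps_const (F []) + letter_fps \<phi> * wt_gf G) d"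
  proof (cases "d = 0")
    case True
    then show ?thesis by (simp add: wt_gf_def wt_indices_0 letter_fps_def)
  next
    case False
    have "inj_on (\<lambda>(a, k). a # k) (SIGMA a:{1..d}. wt_indices (d - a))"
      by (auto simp: inj_on_def)
    then have "(\<Sum>k\<in>wt_indices d. F k) = (\<Sum>(a, k)\<in>(SIGMA a:{1..d}. wt_indices (d - a)). F (a # k))"
      using False by (simp add: wt_indices_pos sum.reindex case_prod_unfold)
    also have "\<dots> = (\<Sum>a = 1..d. \<Sum>k\<in>wt_indices (d - a). F (a # k))"
      by (simp add: sum.Sigma finite_wt_indices)
    also have "\<dots> = (\<Sum>a = 1..d. \<phi> a * (\<Sum>k\<in>wt_indices (d - a). G k))"
      by (auto simp: sum_distrib_left wt_indices_def assms intro!: sum.cong)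
    also have "\<dots> = (\<Sum>a = 0..d. fps_nth (letter_fps \<phi>) a * fps_nth (wt_gf G) (d - a))"
      by (rule sum.mono_neutral_cong_left) (auto simp: letter_fps_def wt_gf_def)
    finally show ?thesis using False by (simp add: fps_mult_nth) (simp add: wt_gf_def)
  qed
qed

lemma wt_gf_Cons_0:
  assumes "F [] = 0" "\<And>a k. a \<ge> 1 \<Longrightarrow> is_index k \<Longrightarrow> F (a # k) = \<phi> a * G k"
  shows "wt_gf F = letter_fps \<phi> * wt_gf G"
  using wt_gf_Cons[of F \<phi> G] assms by simp

lemma real_const_add: "real_const (a + b) = real_const a + real_const b"
  by (simp add: real_const_def poly_const_def)

lemma real_const_mult: "real_const (a * b) = real_const a * real_const b"
  by (simp add: real_const_def poly_const_def)

lemma real_const_0 [simp]: "real_const 0 = 0"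
  by (simp add: real_const_def poly_const_def)

lemma real_const_1 [simp]: "real_const 1 = 1"
  by (simp add: real_const_def poly_const_def flip: one_pCons)

lemma real_const_power: "real_const (a ^ n) = real_const a ^ n"
  by (induction n) (simp_all add: real_const_mult)

section \<open>Interpolated truncations and the letters at one evaluation point\<close>

definition qsym_t :: "series \<Rightarrow> real list \<Rightarrow> nat list \<Rightarrow> series" where
  "qsym_t t xs k = (\<Sum>(m, p)\<leftarrow>merges k. t ^ m * real_const (qsym xs p))"

text \<open>The part of \<open>qsym (x # xs) k\<close> in which the first entry of \<open>k\<close>
  is evaluated at \<open>x\<close>; an empty \<open>k\<close> has no such part.\<close>

fun qsym_head :: "real \<Rightarrow> real list \<Rightarrow> nat list \<Rightarrow> real" where
  "qsym_head x xs [] = 0"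
| "qsym_head x xs (a # k) = x ^ a * qsym xs k"

definition qsym_head_t :: "series \<Rightarrow> real \<Rightarrow> real list \<Rightarrow> nat list \<Rightarrow> series" where
  "qsym_head_t t x xs k = (\<Sum>(m, p)\<leftarrow>merges k. t ^ m * real_const (qsym_head x xs p))"

lemma qsym_qsym_head: "qsym (x # xs) k = qsym xs k + qsym_head x xs k"
  by (cases k) auto

lemma qsym_t_Cons: "qsym_t t (x # xs) k = qsym_t t xs k + qsym_head_t t x xs k"
  unfolding qsym_t_def qsym_head_t_def qsym_qsym_head
  by (simp add: real_const_add distrib_left case_prod_unfold sum_list_addf)

lemma qsym_t_Nil [simp]: "qsym_t t xs [] = 1"
  by (simp add: qsym_t_def)

lemma qsym_head_t_Nil [simp]: "qsym_head_t t x xs [] = 0"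
  by (simp add: qsym_head_t_def)

text \<open>Merging further entries changes the exponent of the first block only additively, and
  that block is evaluated at \<open>x\<close>.\<close>

lemma qsym_head_t_add:
  "qsym_head_t t x xs ((a + b) # k) = real_const (x ^ a) * qsym_head_t t x xs (b # k)"
proof (induction k arbitrary: b)
  case Nil
  show ?case by (simp add: qsym_head_t_def power_add real_const_mult)
next
  case (Cons c k)
  show ?case
    using Cons.IH[of "b + c"]
    by (simp add: qsym_head_t_def o_def case_prod_unfold power_add real_const_mult algebra_simps
        sum_list_const_mult)
qed

text \<open>The comma after \<open>a\<close> decides: if kept, the remaining entries use later
  points only; if replaced by a plus, at the price of a factor \<open>t\<close>, the next entry sits
  at \<open>x\<close> as well.\<close>

lemma qsym_head_t_Cons:
  "qsym_head_t t x xs (a # k) = real_const (x ^ a) * (qsym_t t xs k + t * qsym_head_t t x xs k)"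
proof (cases k)
  case Nil
  then show ?thesis by (simp add: qsym_head_t_def)
next
  case (Cons b l)
  have "qsym_head_t t x xs (a # k) = real_const (x ^ a) * qsym_t t xs k +
    t * qsym_head_t t x xs ((a + b) # l)"
    by (simp add: Cons qsym_head_t_def qsym_t_def o_def case_prod_unfold real_const_mult
      algebra_simps
        sum_list_const_mult)
  then show ?thesis unfolding qsym_head_t_add Cons by (simp add: algebra_simps)
qed

lemma merges_nonempty: "(m, p) \<in> set (merges k) \<Longrightarrow> k \<noteq> [] \<Longrightarrow> p \<noteq> []"
  by (induction k arbitrary: m p rule: merges.induct) auto

lemma qsym_t_Nil_Cons:
  assumes "k \<noteq> []"
  shows "qsym_t t [] k = 0"
proof -
  have "qsym [] p = 0" if "(m, p) \<in> set (merges k)" for m p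
    using merges_nonempty[OF that assms] by (cases p) auto
  then have "map (\<lambda>(m, p). t ^ m * real_const (qsym [] p)) (merges k) = map (\<lambda>_. 0) (merges k)"
    by (intro map_cong refl) auto
  then show ?thesis unfolding qsym_t_def by (simp only: sum_list_0)
qed

section \<open>Generating series over all indices, and with a condition on the first or last
  entry\<close>

definition gen_all :: "series \<Rightarrow> (nat \<Rightarrow> series) \<Rightarrow> real list \<Rightarrow> series fps" where
  "gen_all t g xs = wt_gf (\<lambda>k. prod_list (map g k) * qsym_t t xs k)"

text \<open>The condition is on the first entry because \<open>zeta_txy\<close> reverses the second
  half of a cut index, moving the last entry of an admissible index to the front.\<close>

definition gen_hd :: "series \<Rightarrow> (nat \<Rightarrow> series) \<Rightarrow> real list \<Rightarrow> series fps" where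
  "gen_hd t g xs = wt_gf (\<lambda>k. if k \<noteq> [] \<and> hd k \<ge> 2 then prod_list (map g k) * qsym_t t xs k else 0)"

definition gen_last :: "series \<Rightarrow> (nat \<Rightarrow> series) \<Rightarrow> real list \<Rightarrow> series fps" where
  "gen_last t g xs = wt_gf (\<lambda>k. if k \<noteq> [] \<and> last k \<ge> 2 then prod_list (map g k) * qsym_t t xs k
    else 0)"

definition letter_gf :: "(nat \<Rightarrow> series) \<Rightarrow> real \<Rightarrow> series fps" where
  "letter_gf g x = letter_fps (\<lambda>a. g a * real_const (x ^ a))"

definition big_letter_gf :: "(nat \<Rightarrow> series) \<Rightarrow> real \<Rightarrow> series fps" where
  "big_letter_gf g x = letter_fps (\<lambda>a. if a \<ge> 2 then g a * real_const (x ^ a) else 0)"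

text \<open>Summation of a geometric series in \<open>T * L\<close> with the denominator
  cleared.\<close>

lemma linear_fixpoint:
  fixes E :: "'a::comm_ring_1"
  assumes "E = V + L * (P + T * E)"
  shows "(1 - T * L) * E = V + L * P"
proof -
  have "(1 - T * L) * E = E - T * L * E" by (simp add: left_diff_distrib)
  also have "\<dots> = V + L * (P + T * E) - T * L * E" by (subst (1) assms) (rule refl)
  also have "\<dots> = V + L * P" by (simp add: algebra_simps)
  finally show ?thesis .
qed

lemma wt_gf_qsym_head_t:
  "wt_gf (\<lambda>k. prod_list (map g k) * qsym_head_t t x xs k) =
    letter_gf g x * (gen_all t g xs + fps_const t * wt_gf (\<lambda>k. prod_list (map g k) * qsym_head_t
      t x xs k))"
proof -
  have "wt_gf (\<lambda>k. prod_list (map g k) * qsym_head_t t x xs k) = letter_gf g x *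
      wt_gf (\<lambda>k. prod_list (map g k) * qsym_t t xs k + t * (prod_list (map g k) * qsym_head_t t
        x xs k))"
    unfolding letter_gf_def by (rule wt_gf_Cons_0) (simp_all add: qsym_head_t_Cons algebra_simps)
  then show ?thesis by (simp add: wt_gf_add wt_gf_cmult gen_all_def)
qed

text \<open>With c = \<open>letter_gf g x\<close>, the point \<open>x\<close> contributes the factor
  1 + c / (1 - t c) = (1 + (1 - t) c) / (1 - t c).\<close>

lemma gen_all_Cons:
  "(1 - fps_const t * letter_gf g x) * gen_all t g (x # xs) =
    (1 + fps_const (1 - t) * letter_gf g x) * gen_all t g xs"
proof -
  define D where "D = wt_gf (\<lambda>k. prod_list (map g k) * qsym_head_t t x xs k)"
  have D: "(1 - fps_const t * letter_gf g x) * D = letter_gf g x * gen_all t g xs"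
    unfolding D_def using wt_gf_qsym_head_t linear_fixpoint[of _ 0] by fastforce
  have "gen_all t g (x # xs) = gen_all t g xs + D"
    by (simp add: gen_all_def D_def qsym_t_Cons distrib_left wt_gf_add)
  then have "(1 - fps_const t * letter_gf g x) * gen_all t g (x # xs) =
      (1 - fps_const t * letter_gf g x) * gen_all t g xs + letter_gf g x * gen_all t g xs"
    by (simp only: distrib_left D)
  then show ?thesis by (simp add: algebra_simps flip: fps_const_sub)
qed

text \<open>Only the first letter at \<open>x\<close> has to be at least 2; those following it at
  the same point are arbitrary and sum to 1 / (1 - t c).\<close>

lemma gen_hd_Cons:
  "(1 - fps_const t * letter_gf g x) * gen_hd t g (x # xs) =
    (1 - fps_const t * letter_gf g x) * gen_hd t g xs + big_letter_gf g x * gen_all t g xs"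
proof -
  define D where "D = wt_gf (\<lambda>k. prod_list (map g k) * qsym_head_t t x xs k)"
  have D: "(1 - fps_const t * letter_gf g x) * D = letter_gf g x * gen_all t g xs"
    unfolding D_def using wt_gf_qsym_head_t linear_fixpoint[of _ 0] by fastforce
  define E where "E = wt_gf (\<lambda>k. if k \<noteq> [] \<and> hd k \<ge> 2 then prod_list (map g k) * qsym_head_t t x
    xs k else 0)"
  have "E = big_letter_gf g x *
      wt_gf (\<lambda>k. prod_list (map g k) * qsym_t t xs k + t * (prod_list (map g k) * qsym_head_t t
        x xs k))"
    unfolding big_letter_gf_def E_def
    by (rule wt_gf_Cons_0) (simp_all add: qsym_head_t_Cons algebra_simps)
  then have E: "E = big_letter_gf g x * (gen_all t g xs + fps_const t * D)"
    by (simp add: wt_gf_add wt_gf_cmult gen_all_def D_def)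
  have "gen_hd t g (x # xs) = gen_hd t g xs + E"
    unfolding gen_hd_def E_def wt_gf_add[symmetric]
    by (rule wt_gf_cong) (simp add: qsym_t_Cons distrib_left)
  then have "(1 - fps_const t * letter_gf g x) * gen_hd t g (x # xs) =
      (1 - fps_const t * letter_gf g x) * gen_hd t g xs +
      big_letter_gf g x * ((1 - fps_const t * letter_gf g x) * gen_all t g xs +
        fps_const t * ((1 - fps_const t * letter_gf g x) * D))"
    unfolding E by (simp add: algebra_simps)
  then show ?thesis unfolding D by (simp add: algebra_simps)
qed

lemma gen_last_Cons:
  "(1 - fps_const t * letter_gf g x) * gen_last t g (x # xs) =
    (1 + fps_const (1 - t) * letter_gf g x) * gen_last t g xs + big_letter_gf g x"
proof -
  define E where "E = wt_gf (\<lambda>k. if k \<noteq> [] \<and> last k \<ge> 2 then prod_list (map g k) * qsym_head_t t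
    x xs k else 0)"
  \<comment> \<open>For \<open>a # k\<close> with nonempty \<open>k\<close> the last entry lies in
    \<open>k\<close>; singletons are split off because their only entry carries the condition
    itself.\<close>
  define E1 where "E1 = wt_gf (\<lambda>k. if length k = 1 \<and> hd k \<ge> 2 then prod_list (map g k) *
    qsym_head_t t x xs k else 0)"
  define E2 where "E2 = wt_gf (\<lambda>k. if length k > 1 \<and> last k \<ge> 2 then prod_list (map g k) *
    qsym_head_t t x xs k else 0)"
  have "E = E1 + E2"
    unfolding E_def E1_def E2_def wt_gf_add[symmetric]
  proof (rule wt_gf_cong)
    fix k :: "nat list"
    show "(if k \<noteq> [] \<and> last k \<ge> 2 then prod_list (map g k) * qsym_head_t t x xs k else 0) =
      (if length k = 1 \<and> hd k \<ge> 2 then prod_list (map g k) * qsym_head_t t x xs k else 0) +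
      (if length k > 1 \<and> last k \<ge> 2 then prod_list (map g k) * qsym_head_t t x xs k else 0)"
      by (cases k; cases "tl k") auto
  qed
  moreover have "E1 = big_letter_gf g x * wt_gf (\<lambda>k. if k = [] then 1 else 0)"
    unfolding big_letter_gf_def E1_def
    by (rule wt_gf_Cons_0) (simp_all add: qsym_head_t_Cons)
  then have "E1 = big_letter_gf g x"
    by (subst (asm) wt_gf_Nil) auto
  moreover have "E2 = letter_gf g x * wt_gf (\<lambda>k.
      (if k \<noteq> [] \<and> last k \<ge> 2 then prod_list (map g k) * qsym_t t xs k else 0) +
      t * (if k \<noteq> [] \<and> last k \<ge> 2 then prod_list (map g k) * qsym_head_t t x xs k else 0))"
    unfolding letter_gf_def E2_def
    by (rule wt_gf_Cons_0) (simp_all add: qsym_head_t_Cons algebra_simps)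
  then have "E2 = letter_gf g x * (gen_last t g xs + fps_const t * E)"
    unfolding wt_gf_add wt_gf_cmult by (simp add: gen_last_def E_def)
  moreover have "gen_last t g (x # xs) = gen_last t g xs + E"
    unfolding gen_last_def E_def wt_gf_add[symmetric]
    by (rule wt_gf_cong) (simp add: qsym_t_Cons distrib_left)
  ultimately have E: "E = big_letter_gf g x + letter_gf g x * (gen_last t g xs + fps_const t * E)"
    and P: "gen_last t g (x # xs) = gen_last t g xs + E" by simp_all
  have "(1 - fps_const t * letter_gf g x) * gen_last t g (x # xs) =
      (1 - fps_const t * letter_gf g x) * gen_last t g xs + (big_letter_gf g x +
        letter_gf g x * gen_last t g xs)"
    unfolding P distrib_left linear_fixpoint[OF E] ..
  then show ?thesis by (simp add: algebra_simps flip: fps_const_sub)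
qed

lemma gen_all_Nil: "gen_all t g [] = 1"
  unfolding gen_all_def by (subst wt_gf_Nil) (auto simp: qsym_t_Nil_Cons)

lemma gen_hd_Nil: "gen_hd t g [] = 0"
  unfolding gen_hd_def by (subst wt_gf_Nil) (auto simp: qsym_t_Nil_Cons)

lemma gen_last_Nil: "gen_last t g [] = 0"
  unfolding gen_last_def by (subst wt_gf_Nil) (auto simp: qsym_t_Nil_Cons)

lemma letter_fps_nth_0: "fps_nth (letter_fps \<phi>) 0 = 0"
  by (simp add: letter_fps_def)

text \<open>Passing from (t, g) to (1 - t, -g) exchanges the numerator \<open>v\<close> and the
  denominator \<open>u\<close> of the factor at \<open>x\<close> and negates the big letters.
  Multiplying the resulting recursion of \<open>gen_last\<close> by \<open>gen_all\<close> therefore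
  reproduces, up to sign, the recursion of \<open>gen_hd\<close>.\<close>

theorem gen_hd_eq: "gen_hd t g xs = - gen_last (1 - t) (\<lambda>a. - g a) xs * gen_all t g xs"
proof (induction xs)
  case Nil
  show ?case by (simp add: gen_hd_Nil gen_last_Nil)
next
  case (Cons x xs)
  define c where "c = letter_gf g x"
  define u where "u = 1 - fps_const t * c"
  define v where "v = 1 + fps_const (1 - t) * c"
  have neg: "letter_gf (\<lambda>a. - g a) x = - c" "big_letter_gf (\<lambda>a. - g a) x = - big_letter_gf g x"
    by (auto simp: letter_gf_def big_letter_gf_def letter_fps_def fps_eq_iff c_def)
  have A: "u * gen_all t g (x # xs) = v * gen_all t g xs"
    unfolding u_def v_def c_def by (rule gen_all_Cons)
  have B: "u * gen_hd t g (x # xs) = u * gen_hd t g xs + big_letter_gf g x * gen_all t g xs"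
    unfolding u_def c_def by (rule gen_hd_Cons)
  have P: "v * gen_last (1 - t) (\<lambda>a. - g a) (x # xs) =
      u * gen_last (1 - t) (\<lambda>a. - g a) xs - big_letter_gf g x"
    using gen_last_Cons[of "1 - t" "\<lambda>a. - g a" x xs] by (simp add: neg u_def v_def)
  have "fps_nth u 0 = 1" by (simp add: u_def c_def letter_gf_def letter_fps_nth_0)
  then have "u \<noteq> 0" by auto
  have "u * gen_hd t g (x # xs) =
      - (u * gen_last (1 - t) (\<lambda>a. - g a) xs - big_letter_gf g x) * gen_all t g xs"
    unfolding B Cons.IH by (simp add: algebra_simps)
  also have "\<dots> = - gen_last (1 - t) (\<lambda>a. - g a) (x # xs) * (v * gen_all t g xs)"
    unfolding P[symmetric] by (simp add: ac_simps)
  also have "\<dots> = u * (- gen_last (1 - t) (\<lambda>a. - g a) (x # xs) * gen_all t g (x # xs))"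
    unfolding A[symmetric] by (simp add: ac_simps)
  finally have "u * gen_hd t g (x # xs) =
      u * (- gen_last (1 - t) (\<lambda>a. - g a) (x # xs) * gen_all t g (x # xs))" .
  then show ?case using \<open>u \<noteq> 0\<close> mult_left_cancel by blast
qed

section \<open>The logarithmic derivative\<close>

text \<open>Power sums of two roots with sum \<open>e1\<close> and product \<open>e2\<close>, by
  Newton's recursion, so that the computation stays inside the coefficient ring.\<close>

fun psum :: "'a::comm_ring_1 \<Rightarrow> 'a \<Rightarrow> nat \<Rightarrow> 'a" where
  "psum e1 e2 0 = 2"
| "psum e1 e2 (Suc 0) = e1"
| "psum e1 e2 (Suc (Suc k)) = e1 * psum e1 e2 (Suc k) - e2 * psum e1 e2 k"

lemma psum_scale: "psum (c * e1) (c\<^sup>2 * e2) k = c ^ k * psum e1 e2 k"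
  by (induction e1 e2 k rule: psum.induct) (auto simp: algebra_simps power2_eq_square)

text \<open>This is (1 - \<alpha> x q)(1 - \<beta> x q) for roots \<alpha>, \<beta> with sum
  \<open>e1\<close> and product \<open>e2\<close>, where q is \<open>fps_X\<close>;
  \<open>quad_log_deriv\<close> is its negated logarithmic derivative.\<close>

definition quad :: "series \<Rightarrow> series \<Rightarrow> real \<Rightarrow> series fps" where
  "quad e1 e2 x = 1 - fps_const (e1 * real_const x) * fps_X +
    fps_const (e2 * real_const (x ^ 2)) * fps_X ^ 2"

definition quad_log_deriv :: "series \<Rightarrow> series \<Rightarrow> real \<Rightarrow> series fps" where
  "quad_log_deriv e1 e2 x = Abs_fps (\<lambda>k. real_const (x ^ Suc k) * psum e1 e2 (Suc k))"

lemma quad_nonzero: "quad e1 e2 x \<noteq> 0"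
proof -
  have "fps_nth (quad e1 e2 x) 0 = 1" by (simp add: quad_def)
  then show ?thesis by auto
qed

text \<open>From coefficient 2 on this is Newton's recursion; coefficients 0 and 1 hold the initial
  values.\<close>

lemma deriv_quad: "fps_deriv (quad e1 e2 x) = - quad e1 e2 x * quad_log_deriv e1 e2 x"
proof (rule fps_ext)
  fix n
  consider "n = 0" | "n = 1" | m where "n = Suc (Suc m)"
    by (metis One_nat_def old.nat.exhaust)
  then show "fps_nth (fps_deriv (quad e1 e2 x)) n = fps_nth (- quad e1 e2 x * quad_log_deriv e1
    e2 x) n"
    by cases (simp_all add: quad_def quad_log_deriv_def algebra_simps fps_X_power_mult_nth
      fps_mult_left_const_nth
        real_const_mult power2_eq_square real_const_power numeral_fps_const)
qed

section \<open>Origin of the quadratic and of its parameter\<close>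

definition letter_weight :: "series \<Rightarrow> series \<Rightarrow> series \<Rightarrow> series \<Rightarrow> nat \<Rightarrow> series" where
  "letter_weight h A B C a = h * (if a = 1 then B else A ^ (a - 2) * C)"

text \<open>The letter series is h (B x q + C x^2 q^2 / (1 - A x q)), the second summand being
  geometric; the denominator is cleared.\<close>

lemma letter_gf_letter_weight:
  "(1 - fps_const (A * real_const x) * fps_X) * letter_gf (letter_weight h A B C) x =
    fps_const (h * B * real_const x) * fps_X * (1 - fps_const (A * real_const x) * fps_X) +
    fps_const (h * C * real_const (x ^ 2)) * fps_X ^ 2"
proof (rule fps_ext)
  fix n
  consider "n = 0" | "n = 1" | "n = 2" | m where "n = Suc (Suc (Suc m))"
    by (metis One_nat_def Suc_1 old.nat.exhaust)
  then show "fps_nth ((1 - fps_const (A * real_const x) * fps_X) * letter_gf (letter_weight h A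
    B C) x) n =
    fps_nth (fps_const (h * B * real_const x) * fps_X * (1 - fps_const (A * real_const x) * fps_X) +
    fps_const (h * C * real_const (x ^ 2)) * fps_X ^ 2) n"
    by cases (simp_all add: letter_gf_def letter_fps_def letter_weight_def left_diff_distrib
      right_diff_distrib mult.assoc
        fps_X_power_mult_nth real_const_mult real_const_power power2_eq_square algebra_simps)
qed

definition esym1 :: "series \<Rightarrow> series \<Rightarrow> series \<Rightarrow> series" where
  "esym1 s A B = A + s * B"

definition esym2 :: "series \<Rightarrow> series \<Rightarrow> series \<Rightarrow> series \<Rightarrow> series" where
  "esym2 s A B C = s * (A * B - C)"

text \<open>Here \<gamma> and \<delta> originate: clearing the same denominator turns 1 - c (letter
  series) into a quadratic in q whose elementary symmetric functions are those of the theorem for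
  the parameter s = c h.\<close>

lemma quad_esym:
  "(1 - fps_const c * letter_gf (letter_weight h A B C) x) * (1 - fps_const (A * real_const x) *
    fps_X) =
    quad (esym1 (c * h) A B) (esym2 (c * h) A B C) x"
proof -
  have "(1 - fps_const c * letter_gf (letter_weight h A B C) x) * (1 - fps_const (A * real_const
    x) * fps_X) =
      (1 - fps_const (A * real_const x) * fps_X) -
      fps_const c * ((1 - fps_const (A * real_const x) * fps_X) * letter_gf (letter_weight h A B
        C) x)"
    by (simp add: algebra_simps)
  also have "\<dots> = quad (esym1 (c * h) A B) (esym2 (c * h) A B C) x"
    unfolding letter_gf_letter_weight quad_def esym1_def esym2_def
    by (simp add: fps_const_mult[symmetric] fps_const_add[symmetric] fps_const_sub[symmetric]
        real_const_power real_const_mult power2_eq_square algebra_simps del: fps_const_mult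
          fps_const_add fps_const_sub)
  finally show ?thesis .
qed

text \<open>Numerator and denominator in \<open>gen_all_Cons\<close> are 1 - c (letter series) for c
  = t - 1 and c = t, so both sides are multiplied by the same 1 - A x q.\<close>

lemma gen_all_quad:
  "gen_all t (letter_weight h A B C) (x # xs) * quad (esym1 (t * h) A B) (esym2 (t * h) A B C) x =
   gen_all t (letter_weight h A B C) xs * quad (esym1 ((t - 1) * h) A B) (esym2 ((t - 1) * h) A
     B C) x"
proof -
  have "1 + fps_const (1 - t) * letter_gf (letter_weight h A B C) x =
    1 - fps_const (t - 1) * letter_gf (letter_weight h A B C) x"
    by (simp add: algebra_simps flip: fps_const_sub)
  with gen_all_Cons[of t "letter_weight h A B C" x xs]
  have "(1 - fps_const t * letter_gf (letter_weight h A B C) x) * gen_all t (letter_weight h A B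
    C) (x # xs) =
      (1 - fps_const (t - 1) * letter_gf (letter_weight h A B C) x) * gen_all t (letter_weight h
        A B C) xs"
    by (simp only:)
  from arg_cong[OF this, of "\<lambda>f. f * (1 - fps_const (A * real_const x) * fps_X)"]
  show ?thesis
    unfolding quad_esym[symmetric] by (simp only: mult_ac)
qed

definition log_deriv :: "series \<Rightarrow> series \<Rightarrow> series \<Rightarrow> series \<Rightarrow> real list \<Rightarrow> series fps" where
  "log_deriv e1 e2 d1 d2 xs = Abs_fps (\<lambda>k. real_const (qsym xs [Suc k]) *
     (psum e1 e2 (Suc k) - psum d1 d2 (Suc k)))"

lemma log_deriv_Nil: "log_deriv e1 e2 d1 d2 [] = 0"
  by (simp add: log_deriv_def fps_eq_iff)

lemma log_deriv_Cons:
  "log_deriv e1 e2 d1 d2 (x # xs) = log_deriv e1 e2 d1 d2 xs +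
    quad_log_deriv e1 e2 x - quad_log_deriv d1 d2 x"
  by (simp add: log_deriv_def quad_log_deriv_def fps_eq_iff real_const_add algebra_simps)

text \<open>The product rule is applied to the cleared recursion and the quadratic cancelled. Each
  point adds one summand to \<open>log_deriv\<close>, which explains the depth one sums
  \<open>qsym xs [Suc k]\<close> in its coefficients.\<close>

theorem deriv_gen_all:
  "fps_deriv (gen_all t (letter_weight h A B C) xs) = gen_all t (letter_weight h A B C) xs *
     log_deriv (esym1 (t * h) A B) (esym2 (t * h) A B C)
       (esym1 ((t - 1) * h) A B) (esym2 ((t - 1) * h) A B C) xs"
proof (induction xs)
  case Nil
  show ?case by (simp add: gen_all_Nil log_deriv_Nil)
next
  case (Cons x xs)
  define F where "F = gen_all t (letter_weight h A B C)"
  define D where "D = quad (esym1 (t * h) A B) (esym2 (t * h) A B C) x"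
  define D' where "D' = quad (esym1 ((t - 1) * h) A B) (esym2 ((t - 1) * h) A B C) x"
  define L where "L = quad_log_deriv (esym1 (t * h) A B) (esym2 (t * h) A B C) x"
  define L' where "L' = quad_log_deriv (esym1 ((t - 1) * h) A B) (esym2 ((t - 1) * h) A B C) x"
  define K where "K = log_deriv (esym1 (t * h) A B) (esym2 (t * h) A B C)
       (esym1 ((t - 1) * h) A B) (esym2 ((t - 1) * h) A B C) xs"
  have eq: "F (x # xs) * D = F xs * D'"
    unfolding F_def D_def D'_def by (rule gen_all_quad)
  have D: "fps_deriv D = - D * L" "fps_deriv D' = - D' * L'"
    unfolding D_def D'_def L_def L'_def by (rule deriv_quad)+
  have IH: "fps_deriv (F xs) = F xs * K"
    using Cons.IH by (simp only: F_def K_def)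
  have "fps_deriv (F (x # xs) * D) = fps_deriv (F xs * D')"
    by (simp only: eq)
  then have "F (x # xs) * (- D * L) + fps_deriv (F (x # xs)) * D = F xs * (- D' * L') +
    F xs * K * D'"
    by (simp only: fps_deriv_mult D IH)
  also have "\<dots> = (F xs * D') * (K - L')" by (simp add: algebra_simps)
  also have "\<dots> = (F (x # xs) * D) * (K - L')" by (simp only: eq)
  finally have "fps_deriv (F (x # xs)) * D = F (x # xs) * (K + L - L') * D"
    by (simp add: algebra_simps add_eq_0_iff)
  moreover have "D \<noteq> 0" unfolding D_def by (rule quad_nonzero)
  ultimately have "fps_deriv (F (x # xs)) = F (x # xs) * (K + L - L')"
    using mult_right_cancel by blast
  then show ?case by (simp only: log_deriv_Cons F_def K_def L_def L'_def)
qed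

section \<open>Regularizing the identities\<close>

text \<open>This relation carries polynomial identities between truncated multiple zeta values over to
  the regularized ones.\<close>

inductive series_reg :: "(nat \<Rightarrow> series) \<Rightarrow> series \<Rightarrow> bool" where
  base: "reg s c \<Longrightarrow> series_reg (\<lambda>N. real_const (s N) * r) (real_const c * r)"
| add: "series_reg S F \<Longrightarrow> series_reg T G \<Longrightarrow> series_reg (\<lambda>N. S N + T N) (F + G)"

lemma series_reg_const: "series_reg (\<lambda>_. r) r"
  using series_reg.base[OF reg_const[of 1], of r] by simp

lemma series_reg_real_const: "reg s c \<Longrightarrow> series_reg (\<lambda>N. real_const (s N)) (real_const c)"
  using series_reg.base[of s c 1] by simp

text \<open>The related sequences are finite sums of regularizable real sequences times fixed
  series; products distribute, and \<open>reg_mult\<close> treats the summands.\<close>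

lemma series_reg_mult:
  assumes "series_reg S F" "series_reg T G"
  shows "series_reg (\<lambda>N. S N * T N) (F * G)"
  using assms(1)
proof induction
  case (base s c r)
  from assms(2) show ?case
  proof induction
    case (base s' c' r')
    have "series_reg (\<lambda>N. real_const (s N * s' N) * (r * r')) (real_const (c * c') * (r * r'))"
      by (intro series_reg.base reg_mult base.hyps \<open>reg s c\<close>)
    then show ?case by (simp add: real_const_mult ac_simps)
  next
    case (add S F T G)
    from series_reg.add[OF add.IH] show ?case by (simp add: distrib_left)
  qed
next
  case (add S F T G)
  from series_reg.add[OF add.IH] show ?case by (simp add: distrib_right)
qed

lemma series_reg_uminus: "series_reg S F \<Longrightarrow> series_reg (\<lambda>N. - S N) (- F)"
  using series_reg_mult[OF series_reg_const[of "-1"]] by fastforce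

lemma series_reg_sum:
  "finite A \<Longrightarrow> (\<And>i. i \<in> A \<Longrightarrow> series_reg (S i) (F i)) \<Longrightarrow> series_reg (\<lambda>N. \<Sum>i\<in>A. S i N) (\<Sum>i\<in>A. F i)"
  by (induction A rule: finite_induct) (auto intro: series_reg_const series_reg.add)

lemma series_reg_sum_list:
  "(\<And>p. p \<in> set ps \<Longrightarrow> series_reg (S p) (F p)) \<Longrightarrow> series_reg (\<lambda>N. \<Sum>p\<leftarrow>ps. S p N) (\<Sum>p\<leftarrow>ps. F p)"
  by (induction ps) (auto intro: series_reg_const series_reg.add)

definition real_coeff :: "nat \<Rightarrow> nat \<Rightarrow> nat \<Rightarrow> nat \<Rightarrow> nat \<Rightarrow> nat \<Rightarrow> series \<Rightarrow> real" where
  "real_coeff a b c i j l F =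
     Polynomial.coeff (Polynomial.coeff (Polynomial.coeff (scoeff F a b c) l) j) i"

lemma real_coeff_add:
  "real_coeff a b c i j l (F + G) = real_coeff a b c i j l F + real_coeff a b c i j l G"
  by (simp add: real_coeff_def scoeff_def)

lemma real_coeff_real_const:
  "real_coeff a b c i j l (real_const r * F) = r * real_coeff a b c i j l F"
  by (simp add: real_coeff_def scoeff_def real_const_def poly_const_def)

lemma series_eqI: "(\<And>a b c. scoeff F a b c = scoeff G a b c) \<Longrightarrow> F = G"
  by (simp add: scoeff_def fps_eq_iff)

text \<open>Coefficients are linear over \<open>real_const\<close>, so each real coefficient is
  regularized in the sense of \<open>reg\<close> and fixed by \<open>reg_unique\<close>.\<close>

lemma series_reg_unique:
  assumes "series_reg S F" "series_reg S G"
  shows "F = G"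
proof -
  have "reg (\<lambda>N. real_coeff a b c i j l (S N)) (real_coeff a b c i j l F)" if "series_reg S F"
    for a b c i j l S F
    using that
    by induction (simp_all add: real_coeff_add real_coeff_real_const reg_add reg_mult reg_const)
  then have "real_coeff a b c i j l F = real_coeff a b c i j l G" for a b c i j l
    using assms reg_unique by blast
  then show ?thesis
    unfolding real_coeff_def by (intro series_eqI poly_eqI)
qed

lemma is_index_merges: "(m, p) \<in> set (merges k) \<Longrightarrow> is_index k \<Longrightarrow> is_index p"
proof (induction k arbitrary: m p rule: merges.induct)
  case (3 a b k)
  have ab: "a \<ge> 1" "is_index (b # k)" "is_index ((a + b) # k)"
    using 3(4) by (simp_all add: is_index_Cons)
  show ?case using 3(1)[OF _ ab(2)] 3(2)[OF _ ab(3)] 3(3) ab(1)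
    by (auto simp: is_index_Cons)
qed auto

lemma series_reg_qsym_t: "is_index k \<Longrightarrow> series_reg (\<lambda>N. qsym_t t (recips N) k) (zeta_t t k)"
  unfolding qsym_t_def zeta_t_def case_prod_unfold trunc_zeta_def[symmetric]
  by (intro series_reg_sum_list series_reg_mult series_reg_const series_reg_real_const
    reg_trunc_zeta)
    (metis is_index_merges prod.collapse)

section \<open>Generating series of regularized values\<close>

definition zgen_all :: "series \<Rightarrow> (nat \<Rightarrow> series) \<Rightarrow> series fps" where
  "zgen_all t g = wt_gf (\<lambda>k. prod_list (map g k) * zeta_t t k)"

definition zgen_hd :: "series \<Rightarrow> (nat \<Rightarrow> series) \<Rightarrow> series fps" where
  "zgen_hd t g = wt_gf (\<lambda>k. if k \<noteq> [] \<and> hd k \<ge> 2 then prod_list (map g k) * zeta_t t k else 0)"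

definition zgen_last :: "series \<Rightarrow> (nat \<Rightarrow> series) \<Rightarrow> series fps" where
  "zgen_last t g = wt_gf (\<lambda>k. if k \<noteq> [] \<and> last k \<ge> 2 then prod_list (map g k) * zeta_t t k else 0)"

lemma series_reg_if:
  "(P \<Longrightarrow> series_reg S F) \<Longrightarrow> series_reg (\<lambda>N. if P then S N else 0) (if P then F else 0)"
  by (auto intro: series_reg_const)

lemma series_reg_gen_all:
  "series_reg (\<lambda>N. fps_nth (gen_all t g (recips N)) d) (fps_nth (zgen_all t g) d)"
  unfolding gen_all_def zgen_all_def wt_gf_def fps_nth_Abs_fps
  by (intro series_reg_sum series_reg_mult series_reg_const series_reg_qsym_t finite_wt_indices)
    (simp add: wt_indices_def)

lemma series_reg_gen_hd:
  "series_reg (\<lambda>N. fps_nth (gen_hd t g (recips N)) d) (fps_nth (zgen_hd t g) d)"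
  unfolding gen_hd_def zgen_hd_def wt_gf_def fps_nth_Abs_fps
  by (intro series_reg_sum series_reg_if series_reg_mult series_reg_const series_reg_qsym_t
    finite_wt_indices) (simp add: wt_indices_def)

lemma series_reg_gen_last:
  "series_reg (\<lambda>N. fps_nth (gen_last t g (recips N)) d) (fps_nth (zgen_last t g) d)"
  unfolding gen_last_def zgen_last_def wt_gf_def fps_nth_Abs_fps
  by (intro series_reg_sum series_reg_if series_reg_mult series_reg_const series_reg_qsym_t
    finite_wt_indices) (simp add: wt_indices_def)

lemma series_reg_fps_mult:
  assumes "\<And>d. series_reg (\<lambda>N. fps_nth (S N) d) (fps_nth F d)" "\<And>d. series_reg (\<lambda>N. fps_nth (T
    N) d) (fps_nth G d)"
  shows "series_reg (\<lambda>N. fps_nth (S N * T N) d) (fps_nth (F * G) d)"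
  unfolding fps_mult_nth by (intro series_reg_sum series_reg_mult assms) simp

lemma series_reg_fps_unique:
  assumes "\<And>d. series_reg (\<lambda>N. fps_nth (S N) d) (fps_nth F d)" "\<And>d. series_reg (\<lambda>N. fps_nth (S
    N) d) (fps_nth G d)"
  shows "F = G"
  by (rule fps_ext) (rule series_reg_unique[OF assms])

text \<open>By \<open>gen_hd_eq\<close> both sides regularize the same truncated coefficients, and a
  coefficient of a product involves only finitely many terms.\<close>

theorem zgen_hd_eq: "zgen_hd t g = - zgen_last (1 - t) (\<lambda>a. - g a) * zgen_all t g"
proof (rule series_reg_fps_unique)
  fix d
  show "series_reg (\<lambda>N. fps_nth (gen_hd t g (recips N)) d) (fps_nth (zgen_hd t g) d)"
    by (rule series_reg_gen_hd)
  have "series_reg (\<lambda>N. - fps_nth (gen_last (1 - t) (\<lambda>a. - g a) (recips N) * gen_all t g (recips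
    N)) d)
      (- fps_nth (zgen_last (1 - t) (\<lambda>a. - g a) * zgen_all t g) d)"
    by (intro series_reg_uminus series_reg_fps_mult series_reg_gen_last series_reg_gen_all)
  then show "series_reg (\<lambda>N. fps_nth (gen_hd t g (recips N)) d)
      (fps_nth (- zgen_last (1 - t) (\<lambda>a. - g a) * zgen_all t g) d)"
    unfolding gen_hd_eq by simp
qed

definition zeta_log_deriv :: "series \<Rightarrow> series \<Rightarrow> series \<Rightarrow> series \<Rightarrow> series fps" where
  "zeta_log_deriv e1 e2 d1 d2 = Abs_fps (\<lambda>k. real_const (zeta [Suc k]) *
     (psum e1 e2 (Suc k) - psum d1 d2 (Suc k)))"

lemma series_reg_log_deriv:
  "series_reg (\<lambda>N. fps_nth (log_deriv e1 e2 d1 d2 (recips N)) k) (fps_nth (zeta_log_deriv e1 e2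
    d1 d2) k)"
  unfolding log_deriv_def zeta_log_deriv_def fps_nth_Abs_fps trunc_zeta_def[symmetric]
  by (intro series_reg_mult series_reg_const series_reg_real_const reg_trunc_zeta)
    (simp add: is_index_def)

theorem deriv_zgen_all:
  "fps_deriv (zgen_all t (letter_weight h A B C)) = zgen_all t (letter_weight h A B C) *
     zeta_log_deriv (esym1 (t * h) A B) (esym2 (t * h) A B C)
       (esym1 ((t - 1) * h) A B) (esym2 ((t - 1) * h) A B C)"
proof (rule series_reg_fps_unique)
  fix d
  show "series_reg (\<lambda>N. fps_nth (fps_deriv (gen_all t (letter_weight h A B C) (recips N))) d)
      (fps_nth (fps_deriv (zgen_all t (letter_weight h A B C))) d)"
    unfolding fps_deriv_nth by (intro series_reg_mult series_reg_const series_reg_gen_all)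
  show "series_reg (\<lambda>N. fps_nth (fps_deriv (gen_all t (letter_weight h A B C) (recips N))) d)
      (fps_nth (zgen_all t (letter_weight h A B C) *
     zeta_log_deriv (esym1 (t * h) A B) (esym2 (t * h) A B C)
       (esym1 ((t - 1) * h) A B) (esym2 ((t - 1) * h) A B C)) d)"
    unfolding deriv_gen_all by (intro series_reg_fps_mult series_reg_gen_all series_reg_log_deriv)
qed

lemma zgen_all_0: "fps_nth (zgen_all t g) 0 = 1"
  by (simp add: zgen_all_def wt_gf_def wt_indices_0 zeta_t_def zeta_Nil)

text \<open>The equation fixes coefficient m + 1 up to the factor m + 1, which is cancelled rather
  than divided by, as the coefficients form a domain of characteristic 0.\<close>

lemma ode_unique:
  fixes F G K :: "'a::{idom,semiring_char_0} fps"
  assumes "fps_deriv F = F * K" "fps_deriv G = G * K" "fps_nth F 0 = fps_nth G 0"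
  shows "F = G"
proof -
  have "fps_nth F n = fps_nth G n" for n
  proof (induction n rule: less_induct)
    case (less n)
    show ?case
    proof (cases n)
      case (Suc m)
      have "fps_nth (F * K) m = fps_nth (G * K) m"
        unfolding fps_mult_nth using less.IH Suc by (intro sum.cong) auto
      then have "fps_nth (fps_deriv F) m = fps_nth (fps_deriv G) m"
        using assms(1,2) by simp
      then show ?thesis using Suc by (simp del: of_nat_Suc)
    qed (use assms(3) in simp)
  qed
  then show ?thesis by (rule fps_ext)
qed

section \<open>Coefficients in the space of multiple zeta values\<close>

text \<open>Subrings as sets, since membership in \<open>mzv_series\<close> has to be lifted through
  three polynomial and three power series layers.\<close>

definition closed_ring :: "'a::comm_ring_1 set \<Rightarrow> bool" where
  "closed_ring S \<longleftrightarrow> 0 \<in> S \<and> 1 \<in> S \<and> (\<forall>x\<in>S. - x \<in> S) \<and> (\<forall>x\<in>S. \<forall>y\<in>S. x + y \<in> S \<and> x * y \<in> S)"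

lemma closed_ringD:
  assumes "closed_ring S"
  shows "0 \<in> S" "1 \<in> S" "x \<in> S \<Longrightarrow> - x \<in> S" "x \<in> S \<Longrightarrow> y \<in> S \<Longrightarrow> x + y \<in> S"
    "x \<in> S \<Longrightarrow> y \<in> S \<Longrightarrow> x * y \<in> S"
  using assms by (auto simp: closed_ring_def)

lemma closed_ring_diff: "closed_ring S \<Longrightarrow> x \<in> S \<Longrightarrow> y \<in> S \<Longrightarrow> x - y \<in> S"
  using closed_ringD(4)[of S x "- y"] closed_ringD(3)[of S y] by simp

lemma closed_ring_sum: "closed_ring S \<Longrightarrow> (\<And>i. i \<in> A \<Longrightarrow> f i \<in> S) \<Longrightarrow> sum f A \<in> S"
  by (induction A rule: infinite_finite_induct) (auto simp: closed_ringD)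

lemma closed_ring_sum_list: "closed_ring S \<Longrightarrow> (\<And>x. x \<in> set xs \<Longrightarrow> x \<in> S) \<Longrightarrow> sum_list xs \<in> S"
  by (induction xs) (auto simp: closed_ringD)

lemma closed_ring_power: "closed_ring S \<Longrightarrow> x \<in> S \<Longrightarrow> x ^ n \<in> S"
  by (induction n) (auto simp: closed_ringD)

lemma closed_ring_numeral: "closed_ring S \<Longrightarrow> numeral n \<in> S"
  by (induction n) (simp_all only: numeral.simps closed_ringD)

definition poly_over :: "'a::comm_ring_1 set \<Rightarrow> 'a poly set" where
  "poly_over S = {p. \<forall>i. Polynomial.coeff p i \<in> S}"

definition fps_over :: "'a::comm_ring_1 set \<Rightarrow> 'a fps set" where
  "fps_over S = {f. \<forall>n. fps_nth f n \<in> S}"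

lemma closed_ring_poly_over: "closed_ring S \<Longrightarrow> closed_ring (poly_over S)"
  unfolding closed_ring_def[of "poly_over S"]
  by (auto simp: poly_over_def coeff_mult coeff_1 intro!: closed_ringD closed_ring_sum)

lemma closed_ring_fps_over: "closed_ring S \<Longrightarrow> closed_ring (fps_over S)"
  unfolding closed_ring_def[of "fps_over S"]
  by (auto simp: fps_over_def fps_mult_nth fps_one_nth intro!: closed_ringD closed_ring_sum)

lemma pCons_poly_over: "a \<in> S \<Longrightarrow> p \<in> poly_over S \<Longrightarrow> pCons a p \<in> poly_over S"
  by (auto simp: poly_over_def coeff_pCons split: nat.splits)

lemma fps_const_fps_over: "closed_ring S \<Longrightarrow> a \<in> S \<Longrightarrow> fps_const a \<in> fps_over S"
  by (auto simp: fps_over_def closed_ringD)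

lemma fps_X_fps_over: "closed_ring S \<Longrightarrow> fps_X \<in> fps_over S"
  by (auto simp: fps_over_def closed_ringD fps_X_nth)

lemma closed_ring_mzv_space: "closed_ring mzv_space"
  unfolding closed_ring_def
  using mzv_space_rat[of 0] mzv_space_rat[of 1] mzv_space_uminus mzv_space_add mzv_space_mult by
    auto

lemma mzv_series_eq:
  "mzv_series = fps_over (fps_over (fps_over (poly_over (poly_over (poly_over mzv_space)))))"
  by (auto simp: mzv_series_def fps_over_def poly_over_def scoeff_def)

lemmas closed_ring_over = closed_ring_poly_over closed_ring_fps_over closed_ring_mzv_space

lemma closed_ring_mzv_series: "closed_ring mzv_series"
  unfolding mzv_series_eq by (intro closed_ring_over)

lemma poly_const_mzv_series:
  "p \<in> poly_over (poly_over (poly_over mzv_space)) \<Longrightarrow> poly_const p \<in> mzv_series"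
  unfolding mzv_series_eq poly_const_def by (intro fps_const_fps_over closed_ring_over)

lemma ind_mzv_series:
  "ind_t \<in> mzv_series" "ind_x \<in> mzv_series" "ind_y \<in> mzv_series"
  "ind_X \<in> mzv_series" "ind_Y \<in> mzv_series" "ind_Z \<in> mzv_series"
  unfolding ind_t_def ind_x_def ind_y_def ind_X_def ind_Y_def ind_Z_def
  by (intro poly_const_mzv_series pCons_poly_over closed_ringD closed_ring_over)+
    (unfold mzv_series_eq, (intro fps_const_fps_over fps_X_fps_over closed_ring_over)+)

lemma real_const_mzv_series: "r \<in> mzv_space \<Longrightarrow> real_const r \<in> mzv_series"
  unfolding real_const_def
  by (intro poly_const_mzv_series pCons_poly_over closed_ringD closed_ring_over)

lemma scoeff_series_sum:
  "scoeff (series_sum A f) a b c = (\<Sum>i | i \<in> A \<and> scoeff (f i) a b c \<noteq> 0. scoeff (f i) a b c)"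
  by (simp add: series_sum_def scoeff_def)

lemma mzv_series_iff:
  "F \<in> mzv_series \<longleftrightarrow> (\<forall>a b c. scoeff F a b c \<in> poly_over (poly_over (poly_over mzv_space)))"
  by (auto simp: mzv_series_def poly_over_def)

lemma series_sum_mzv_series: "(\<And>i. i \<in> A \<Longrightarrow> f i \<in> mzv_series) \<Longrightarrow> series_sum A f \<in> mzv_series"
  unfolding mzv_series_iff scoeff_series_sum
  by (intro allI closed_ring_sum closed_ring_over) auto

lemmas mzv_series_intros = closed_ringD(4,5)[OF closed_ring_mzv_series]
  closed_ringD(2)[OF closed_ring_mzv_series]
  closed_ring_diff[OF closed_ring_mzv_series] closed_ring_power[OF closed_ring_mzv_series]
  closed_ring_numeral[OF closed_ring_mzv_series]

lemma zeta_t_mzv_series: "t \<in> mzv_series \<Longrightarrow> zeta_t t k \<in> mzv_series"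
  unfolding zeta_t_def
  by (rule closed_ring_sum_list[OF closed_ring_mzv_series])
    (auto intro!: mzv_series_intros real_const_mzv_series zeta_in_mzv_space)

lemma zeta_txy_mzv_series:
  "t \<in> mzv_series \<Longrightarrow> x \<in> mzv_series \<Longrightarrow> y \<in> mzv_series \<Longrightarrow> zeta_txy t x y k \<in> mzv_series"
  unfolding zeta_txy_def
  by (intro closed_ring_sum closed_ring_mzv_series mzv_series_intros zeta_t_mzv_series)

lemma u_monom_mzv_series:
  "A \<in> mzv_series \<Longrightarrow> B \<in> mzv_series \<Longrightarrow> C \<in> mzv_series \<Longrightarrow> u_monom A B C k \<in> mzv_series"
  unfolding u_monom_def by (intro mzv_series_intros)

lemma Phi_mzv_series:
  "t \<in> mzv_series \<Longrightarrow> A \<in> mzv_series \<Longrightarrow> B \<in> mzv_series \<Longrightarrow> C \<in> mzv_series \<Longrightarrow> Phi t A B C \<in> mzv_series"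
  unfolding Phi_def
  by (intro series_sum_mzv_series mzv_series_intros zeta_t_mzv_series u_monom_mzv_series)

lemma Phi_xy_mzv_series:
  "t \<in> mzv_series \<Longrightarrow> x \<in> mzv_series \<Longrightarrow> y \<in> mzv_series \<Longrightarrow>
    A \<in> mzv_series \<Longrightarrow> B \<in> mzv_series \<Longrightarrow> C \<in> mzv_series \<Longrightarrow> Phi_xy t x y A B C \<in> mzv_series"
  unfolding Phi_xy_def
  by (intro series_sum_mzv_series mzv_series_intros zeta_txy_mzv_series u_monom_mzv_series)

text \<open>The roots in the algebraic closure obey Newton's recursion too, so their power sums are
  images of \<open>psum\<close> and the roots disappear from \<open>exponent\<close>.\<close>

lemma root_pair_psum:
  assumes "root_pair s \<alpha> \<beta>"
  shows "\<alpha> ^ k + \<beta> ^ k = ext_emb (psum (esym1 s ind_X ind_Y) (esym2 s ind_X ind_Y ind_Z) k)"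
proof (induction "esym1 s ind_X ind_Y" "esym2 s ind_X ind_Y ind_Z" k rule: psum.induct)
  case 1
  have "1 = ext_emb 1" by (simp add: ext_emb_def flip: One_fract_def)
  then show ?case by (metis ext_emb_simps(1) one_add_one power_0 psum.simps(1))
next
  case 2
  then show ?case using assms by (simp add: root_pair_def esym1_def)
next
  case (3 k)
  have "\<alpha> ^ Suc (Suc k) + \<beta> ^ Suc (Suc k) =
      (\<alpha> + \<beta>) * (\<alpha> ^ Suc k + \<beta> ^ Suc k) - (\<alpha> * \<beta>) * (\<alpha> ^ k + \<beta> ^ k)"
    by (simp add: algebra_simps)
  then show ?case
    using assms unfolding 3 psum.simps ext_emb_simps(2,3)
    by (simp only: root_pair_def esym1_def esym2_def)
qed

lemma exponent_eq:
  assumes "root_pair s \<gamma> \<delta>" "root_pair s' \<gamma>' \<delta>'"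
  shows "exponent x y \<gamma> \<delta> \<gamma>' \<delta>' = series_sum {2..} (\<lambda>k.
     real_const (zeta [k] / real k) * (x ^ k + y ^ k) *
     (psum (esym1 s ind_X ind_Y) (esym2 s ind_X ind_Y ind_Z) k -
      psum (esym1 s' ind_X ind_Y) (esym2 s' ind_X ind_Y ind_Z) k))"
proof -
  have "\<gamma> ^ k + \<delta> ^ k - \<gamma>' ^ k - \<delta>' ^ k = ext_emb
     (psum (esym1 s ind_X ind_Y) (esym2 s ind_X ind_Y ind_Z) k -
      psum (esym1 s' ind_X ind_Y) (esym2 s' ind_X ind_Y ind_Z) k)" for k
    unfolding ext_emb_simps root_pair_psum[OF assms(1), symmetric] root_pair_psum[OF assms(2),
      symmetric]
    by simp
  then show ?thesis by (simp only: exponent_def from_ext_emb)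
qed

lemma psum_mzv_series: "e1 \<in> mzv_series \<Longrightarrow> e2 \<in> mzv_series \<Longrightarrow> psum e1 e2 k \<in> mzv_series"
  by (induction e1 e2 k rule: psum.induct) (auto intro!: mzv_series_intros)

lemma exponent_mzv_series:
  assumes "root_pair s \<gamma> \<delta>" "root_pair s' \<gamma>' \<delta>'"
    and "s \<in> mzv_series" "s' \<in> mzv_series" "x \<in> mzv_series" "y \<in> mzv_series"
  shows "exponent x y \<gamma> \<delta> \<gamma>' \<delta>' \<in> mzv_series"
proof -
  have "zeta [k] / real k \<in> mzv_space" for k
    using mzv_space_scale[OF zeta_in_mzv_space[of "[k]"], of "1 / of_nat k"]
    by (simp add: of_rat_divide)
  then show ?thesis
    unfolding exponent_eq[OF assms(1,2)] esym1_def esym2_def using assms(3-)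
    by (intro series_sum_mzv_series mzv_series_intros real_const_mzv_series psum_mzv_series
      ind_mzv_series)
qed

section \<open>Grading by weight\<close>

text \<open>Z counts twice so that \<open>u_monom\<close> at X, Y, Z has degree (wt - dep - ht) +
  (dep - ht) + 2 ht = wt.\<close>

definition hpart :: "nat \<Rightarrow> series \<Rightarrow> series" where
  "hpart d F = Abs_fps (\<lambda>c. Abs_fps (\<lambda>b. Abs_fps (\<lambda>a.
     if a + b + 2 * c = d then scoeff F a b c else 0)))"

lemma scoeff_hpart: "scoeff (hpart d F) a b c = (if a + b + 2 * c = d then scoeff F a b c else 0)"
  by (simp add: hpart_def scoeff_def)

lemma scoeff_add: "scoeff (F + G) a b c = scoeff F a b c + scoeff G a b c"
  by (simp add: scoeff_def)

lemma scoeff_diff: "scoeff (F - G) a b c = scoeff F a b c - scoeff G a b c"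
  by (simp add: scoeff_def)

lemma scoeff_0 [simp]: "scoeff 0 a b c = 0"
  by (simp add: scoeff_def)

lemma scoeff_sum: "scoeff (\<Sum>i\<in>A. f i) a b c = (\<Sum>i\<in>A. scoeff (f i) a b c)"
  by (simp add: scoeff_def fps_sum_nth)

lemma scoeff_mult: "scoeff (F * G) a b c =
   (\<Sum>i\<le>c. \<Sum>j\<le>b. \<Sum>l\<le>a. scoeff F l j i * scoeff G (a - l) (b - j) (c - i))"
  by (simp add: scoeff_def fps_mult_nth fps_sum_nth atLeast0AtMost)

lemma hpart_mult: "hpart d (F * G) = (\<Sum>e\<le>d. hpart e F * hpart (d - e) G)"
proof (rule series_eqI)
  fix a b c
  \<comment> \<open>A pair of monomials is seen only by the summand with
    \<open>e = l + j + 2 * i\<close>, the degree of the left one.\<close>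
  have inner: "(\<Sum>e\<le>d. scoeff (hpart e F) l j i * scoeff (hpart (d - e) G) (a - l) (b - j) (c - i)) =
      (if a + b + 2 * c = d then scoeff F l j i * scoeff G (a - l) (b - j) (c - i) else 0)"
    if "i \<le> c" "j \<le> b" "l \<le> a" for i j l
  proof -
    let ?v = "scoeff F l j i * scoeff G (a - l) (b - j) (c - i)"
    have "(\<Sum>e\<le>d. scoeff (hpart e F) l j i * scoeff (hpart (d - e) G) (a - l) (b - j) (c - i)) =
        (\<Sum>e\<le>d. if e = l + j + 2 * i then (if a + b + 2 * c = d then ?v else 0) else 0)"
      using that by (intro sum.cong refl) (auto simp: scoeff_hpart)
    also have "\<dots> = (if a + b + 2 * c = d then ?v else 0)"
      using that by (auto simp: sum.delta)
    finally show ?thesis .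
  qed
  have "scoeff (\<Sum>e\<le>d. hpart e F * hpart (d - e) G) a b c =
      (\<Sum>e\<le>d. \<Sum>i\<le>c. \<Sum>j\<le>b. \<Sum>l\<le>a.
        scoeff (hpart e F) l j i * scoeff (hpart (d - e) G) (a - l) (b - j) (c - i))"
    by (simp only: scoeff_sum scoeff_mult)
  also have "\<dots> = (\<Sum>i\<le>c. \<Sum>e\<le>d. \<Sum>j\<le>b. \<Sum>l\<le>a.
        scoeff (hpart e F) l j i * scoeff (hpart (d - e) G) (a - l) (b - j) (c - i))"
    by (rule sum.swap)
  also have "\<dots> = (\<Sum>i\<le>c. \<Sum>j\<le>b. \<Sum>e\<le>d. \<Sum>l\<le>a.
        scoeff (hpart e F) l j i * scoeff (hpart (d - e) G) (a - l) (b - j) (c - i))"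
    by (rule sum.cong[OF refl], rule sum.swap)
  also have "\<dots> = (\<Sum>i\<le>c. \<Sum>j\<le>b. \<Sum>l\<le>a. \<Sum>e\<le>d.
        scoeff (hpart e F) l j i * scoeff (hpart (d - e) G) (a - l) (b - j) (c - i))"
    by (rule sum.cong[OF refl], rule sum.cong[OF refl], rule sum.swap)
  also have "\<dots> = (\<Sum>i\<le>c. \<Sum>j\<le>b. \<Sum>l\<le>a.
      (if a + b + 2 * c = d then scoeff F l j i * scoeff G (a - l) (b - j) (c - i) else 0))"
    by (intro sum.cong refl inner) auto
  also have "\<dots> = scoeff (hpart d (F * G)) a b c"
    by (simp add: scoeff_hpart scoeff_mult)
  finally show "scoeff (hpart d (F * G)) a b c = scoeff (\<Sum>e\<le>d. hpart e F * hpart (d - e) G) a b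
    c" ..
qed

text \<open>The injective ring homomorphism that substitutes \<open>(qX, qY, q\<^sup>2Z)\<close> for \<open>(X, Y, Z)\<close>.\<close>

definition grade :: "series \<Rightarrow> series fps" where
  "grade F = Abs_fps (\<lambda>d. hpart d F)"

lemma inj_grade: "grade F = grade G \<Longrightarrow> F = G"
proof (rule series_eqI)
  fix a b c assume "grade F = grade G"
  then have "hpart (a + b + 2 * c) F = hpart (a + b + 2 * c) G"
    by (simp add: grade_def fps_eq_iff)
  from arg_cong[OF this, of "\<lambda>H. scoeff H a b c"] show "scoeff F a b c = scoeff G a b c"
    by (simp add: scoeff_hpart)
qed

lemma grade_diff: "grade (F - G) = grade F - grade G"
  by (auto simp: grade_def fps_eq_iff[where 'a = series] scoeff_hpart scoeff_diff intro!:
    series_eqI)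

lemma grade_mult: "grade (F * G) = grade F * grade G"
  by (rule fps_ext) (simp add: grade_def hpart_mult fps_mult_nth atLeast0AtMost)

section \<open>Homogeneous elements\<close>

definition homog :: "nat \<Rightarrow> series \<Rightarrow> bool" where
  "homog d F \<longleftrightarrow> (\<forall>a b c. scoeff F a b c \<noteq> 0 \<longrightarrow> a + b + 2 * c = d)"

lemma hpart_homog: "homog d F \<Longrightarrow> hpart e F = (if e = d then F else 0)"
  by (intro series_eqI) (auto simp: homog_def scoeff_hpart)

lemma homog_iff_hpart: "homog d F \<longleftrightarrow> hpart d F = F"
proof
  assume "hpart d F = F"
  then show "homog d F" unfolding homog_def by (metis scoeff_hpart)
qed (simp add: hpart_homog)

lemma homog_mult:
  assumes "homog d F" "homog e G"
  shows "homog (d + e) (F * G)"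
proof -
  have "hpart (d + e) (F * G) = (\<Sum>i\<le>d + e. if i = d then F * G else 0)"
    unfolding hpart_mult by (intro sum.cong refl) (auto simp:
      hpart_homog[OF assms(1)] hpart_homog[OF assms(2)])
  then show ?thesis by (simp add: homog_iff_hpart)
qed

lemma homog_add: "homog d F \<Longrightarrow> homog d G \<Longrightarrow> homog d (F + G)"
  unfolding homog_def scoeff_add by (metis add.right_neutral)

lemma homog_diff: "homog d F \<Longrightarrow> homog d G \<Longrightarrow> homog d (F - G)"
  unfolding homog_def scoeff_diff by (metis diff_zero diff_self)

lemma homog_0 [simp]: "homog d 0"
  by (simp add: homog_def)

lemma homog_poly_const: "homog 0 (poly_const p)"
  by (simp add: homog_def scoeff_def poly_const_def)

lemma homog_1: "homog 0 1"
  using homog_poly_const[of 1] by (simp add: poly_const_def)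

lemma homog_real_const: "homog 0 (real_const r)"
  unfolding real_const_def by (rule homog_poly_const)

lemma homog_numeral: "homog 0 (numeral n)"
  by (induction n) (auto simp only: numeral.simps intro!: homog_1 homog_add)

lemma homog_mult_left: "homog 0 F \<Longrightarrow> homog d G \<Longrightarrow> homog d (F * G)"
  using homog_mult[of 0 F d G] by simp

lemma homog_power: "homog d F \<Longrightarrow> homog (n * d) (F ^ n)"
  by (induction n) (auto intro: homog_1 homog_mult)

lemma homog_power_0: "homog 0 F \<Longrightarrow> homog 0 (F ^ n)"
  using homog_power[of 0 F n] by simp

lemma homog_sum: "(\<And>i. i \<in> A \<Longrightarrow> homog d (f i)) \<Longrightarrow> homog d (sum f A)"
  by (induction A rule: infinite_finite_induct) (auto intro: homog_add)

lemma homog_sum_list: "(\<And>x. x \<in> set xs \<Longrightarrow> homog d x) \<Longrightarrow> homog d (sum_list xs)"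
  by (induction xs) (auto intro: homog_add)

lemma homog_ind:
  "homog 0 ind_t" "homog 0 ind_x" "homog 0 ind_y" "homog 1 ind_X" "homog 1 ind_Y" "homog 2 ind_Z"
  unfolding ind_t_def ind_x_def ind_y_def
  by (rule homog_poly_const)+
    (auto simp: homog_def scoeff_def ind_X_def ind_Y_def ind_Z_def fps_X_nth split: if_splits)

lemma homog_zeta_t: "homog 0 t \<Longrightarrow> homog 0 (zeta_t t k)"
  unfolding zeta_t_def
  by (rule homog_sum_list) (auto intro!: homog_mult_left homog_power_0 homog_real_const)

lemma homog_psum: "homog 1 e1 \<Longrightarrow> homog 2 e2 \<Longrightarrow> homog k (psum e1 e2 k)"
proof (induction e1 e2 k rule: psum.induct)
  case (3 e1 e2 k)
  then show ?case
    using homog_mult[of 1 e1 "Suc k" "psum e1 e2 (Suc k)"] homog_mult[of 2 e2 k "psum e1 e2 k"]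
    by (auto intro!: homog_diff)
qed (auto intro: homog_numeral)

text \<open>Replaces a formal sum over infinitely many indices by a finite sum in each degree, the
  form in which \<open>wt_gf\<close> is defined.\<close>

lemma grade_series_sum:
  assumes "\<And>i. i \<in> A \<Longrightarrow> homog (w i) (f i)" "\<And>d. finite {i \<in> A. w i = d}"
  shows "fps_nth (grade (series_sum A f)) d = (\<Sum>i | i \<in> A \<and> w i = d. f i)"
proof (rule series_eqI)
  fix a b c
  show "scoeff (fps_nth (grade (series_sum A f)) d) a b c = scoeff (\<Sum>i | i \<in> A \<and> w i =
    d. f i) a b c"
  proof (cases "a + b + 2 * c = d")
    case True
    have "(\<Sum>i | i \<in> A \<and> scoeff (f i) a b c \<noteq> 0. scoeff (f i) a b c) =
        (\<Sum>i | i \<in> A \<and> w i = d. scoeff (f i) a b c)"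
    proof (rule sum.mono_neutral_left)
      show "finite {i \<in> A. w i = d}" by (rule assms(2))
      show "{i \<in> A. scoeff (f i) a b c \<noteq> 0} \<subseteq> {i \<in> A. w i = d}"
        using assms(1) True by (auto simp: homog_def)
    qed auto
    then show ?thesis using True by (simp add: grade_def scoeff_hpart scoeff_series_sum scoeff_sum)
  next
    case False
    have "(\<Sum>i | i \<in> A \<and> w i = d. scoeff (f i) a b c) = 0"
      using assms(1) False by (intro sum.neutral) (auto simp: homog_def)
    then show ?thesis using False by (simp add: grade_def scoeff_hpart scoeff_sum)
  qed
qed

section \<open>The exponential under the grading\<close>

definition exp_fps :: "series fps" where
  "exp_fps = Abs_fps (\<lambda>n. real_const (1 / fact n))"

lemma real_const_of_nat: "real_const (real n) = of_nat n"
  by (induction n) (simp_all add: real_const_add)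

lemma deriv_exp_fps: "fps_deriv exp_fps = exp_fps"
proof (rule fps_ext)
  fix n
  have "fps_nth (fps_deriv exp_fps) n = real_const (real (Suc n) * (1 / fact (Suc n)))"
    by (simp only: fps_deriv_nth exp_fps_def fps_nth_Abs_fps real_const_mult real_const_of_nat
      Suc_eq_plus1)
  also have "real (Suc n) * (1 / fact (Suc n)) = 1 / fact n" by
    (simp add: field_simps del: of_nat_Suc)
  finally show "fps_nth (fps_deriv exp_fps) n = fps_nth exp_fps n" by (simp add: exp_fps_def)
qed

lemma grade_1: "grade 1 = 1"
  by (rule fps_ext) (simp add: grade_def hpart_homog[OF homog_1])

lemma grade_power: "grade (F ^ n) = grade F ^ n"
  by (induction n) (simp_all add: grade_1 grade_mult)

text \<open>Without a part of degree 0, the n-th power starts in degree n or later. Hence only n up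
  to d matter in degree d, and \<open>series_exp\<close> becomes a composition of power series, to
  which the chain rule applies.\<close>

lemma grade_series_exp:
  assumes "fps_nth (grade F) 0 = 0"
  shows "grade (series_exp F) = exp_fps oo grade F"
proof (rule fps_ext, rule series_eqI)
  fix d a b c
  show "scoeff (fps_nth (grade (series_exp F)) d) a b c =
    scoeff (fps_nth (exp_fps oo grade F) d) a b c"
  proof (cases "a + b + 2 * c = d")
    case True
    have eq: "scoeff (real_const (1 / fact n) * F ^ n) a b c =
        scoeff (real_const (1 / fact n) * fps_nth (grade F ^ n) d) a b c" for n
    proof -
      have "fps_nth (grade (real_const (1 / fact n) * F ^ n)) d =
          real_const (1 / fact n) * fps_nth (grade (F ^ n)) d"
      proof -
        have "grade (real_const r) = fps_const (real_const r)" for r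
          by (rule fps_ext) (simp add: grade_def hpart_homog[OF homog_real_const])
        then show ?thesis by (simp add: grade_mult)
      qed
      then show ?thesis using True
        by (simp add: grade_power[symmetric]) (metis (no_types, lifting) fps_nth_Abs_fps
          grade_def scoeff_hpart)
    qed
    have zero: "fps_nth (grade F ^ n) d = 0" if "n > d" for n
      using startsby_zero_power_prefix[OF assms, of n] that by auto
    have "scoeff (series_exp F) a b c = (\<Sum>n\<in>{0..d}. scoeff (real_const (1 / fact n) * F ^ n) a b c)"
      unfolding series_exp_def scoeff_series_sum
    proof (rule sum.mono_neutral_left)
      show "{n \<in> UNIV. scoeff (real_const (1 / fact n) * F ^ n) a b c \<noteq> 0} \<subseteq> {0..d}"
        unfolding eq using zero by (auto simp: not_less[symmetric])
    qed auto
    then show ?thesis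
      using True unfolding eq
      by (simp add: grade_def scoeff_hpart fps_compose_nth scoeff_sum exp_fps_def)
  next
    case False
    have "scoeff (real_const (1 / fact n) * fps_nth (grade F ^ n) d) a b c = 0" for n
      using False unfolding grade_power[symmetric]
      by (simp add: grade_def real_const_def poly_const_def scoeff_def hpart_def)
    then show ?thesis
      using False by (simp add: grade_def scoeff_hpart fps_compose_nth scoeff_sum exp_fps_def)
  qed
qed

lemma deriv_grade_series_exp:
  assumes "fps_nth (grade F) 0 = 0"
  shows "fps_deriv (grade (series_exp F)) = grade (series_exp F) * fps_deriv (grade F)"
  unfolding grade_series_exp[OF assms] fps_compose_deriv[OF assms] deriv_exp_fps ..

lemma grade_series_exp_0:
  assumes "fps_nth (grade F) 0 = 0"
  shows "fps_nth (grade (series_exp F)) 0 = 1"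
  unfolding grade_series_exp[OF assms] by (simp add: exp_fps_def)

section \<open>Cutting indices in two\<close>

lemma ht_le_dep: "ht k \<le> dep k"
  by (simp add: ht_def dep_def)

lemma dep_ht_le_wt: "is_index k \<Longrightarrow> dep k + ht k \<le> wt k"
  by (induction k) (auto simp: is_index_Cons dep_def ht_def wt_def)

text \<open>The exponents of \<open>u_monom\<close> add up letter by letter; their natural number
  subtractions are genuine by \<open>ht_le_dep\<close> and \<open>dep_ht_le_wt\<close>.\<close>

lemma prod_list_letter_weight:
  "is_index k \<Longrightarrow> prod_list (map (letter_weight h A B C) k) = h ^ dep k * u_monom A B C k"
proof (induction k)
  case Nil
  show ?case by (simp add: u_monom_def dep_def ht_def wt_def)
next
  case (Cons a k)
  have k: "is_index k" and a: "a \<ge> 1" using Cons.prems by (simp_all add: is_index_Cons)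
  have d: "dep (a # k) = Suc (dep k)" "wt (a # k) = a + wt k"
    by (simp_all add: dep_def wt_def)
  have "u_monom A B C (a # k) = (if a = 1 then B else A ^ (a - 2) * C) * u_monom A B C k"
  proof (cases "a = 1")
    case True
    then have ht: "ht (a # k) = ht k" by (simp add: ht_def)
    show ?thesis
      unfolding u_monom_def d ht using True by (simp add: Suc_diff_le ht_le_dep)
  next
    case False
    then have ht: "ht (a # k) = Suc (ht k)" using a by (simp add: ht_def)
    have wt: "a + wt k - Suc (dep k) - Suc (ht k) = (a - 2) + (wt k - dep k - ht k)"
      using dep_ht_le_wt[OF k] a False by simp
    show ?thesis unfolding u_monom_def d ht wt using False by (simp add: power_add)
  qed
  then show ?case using Cons.IH[OF k] by (simp add: letter_weight_def d)
qed

lemma homog_letter_weight: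
  assumes "homog 0 h" "homog 1 A" "homog 1 B" "homog 2 C" "a \<ge> 1"
  shows "homog a (letter_weight h A B C a)"
proof (cases "a = 1")
  case False
  have "homog ((a - 2) * 1 + 2) (A ^ (a - 2) * C)"
    by (intro homog_mult homog_power assms)
  moreover have "(a - 2) * 1 + 2 = a" using False assms(5) by simp
  ultimately show ?thesis using False assms(1) by (simp add: letter_weight_def homog_mult_left)
qed (use assms in \<open>simp add: letter_weight_def homog_mult_left\<close>)

lemma homog_prod_list_letter_weight:
  assumes "homog 0 h" "homog 1 A" "homog 1 B" "homog 2 C" "is_index k"
  shows "homog (wt k) (prod_list (map (letter_weight h A B C) k))"
  using assms(5)
proof (induction k)
  case Nil
  show ?case by (simp add: wt_def homog_1)
next
  case (Cons a k)
  then have "homog (a + wt k) (letter_weight h A B C a * prod_list (map (letter_weight h A B C) k))"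
    by (intro homog_mult homog_letter_weight assms) (simp_all add: is_index_Cons)
  then show ?case by (simp add: wt_def)
qed

lemma indices_I_wt: "{k \<in> indices_I. wt k = d} = {k \<in> wt_indices d. k \<noteq> [] \<and> last k \<ge> 2}"
  by (auto simp: indices_I_def admissible_def wt_indices_def)

lemma grade_indices_I:
  assumes "homog 0 h" "homog 1 A" "homog 1 B" "homog 2 C" "\<And>k. homog 0 (z k)"
  shows "fps_nth (grade (series_sum indices_I (\<lambda>k. h ^ dep k * z k * u_monom A B C k))) d =
    (\<Sum>k | k \<in> wt_indices d \<and> k \<noteq> [] \<and> last k \<ge> 2. prod_list (map (letter_weight h A B C) k) * z k)"
proof -
  have ix: "is_index k" if "k \<in> indices_I" for k
    using that by (simp add: indices_I_def admissible_def)
  have eq: "h ^ dep k * z k * u_monom A B C k = z k * prod_list (map (letter_weight h A B C) k)"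
    if "is_index k" for k
    using prod_list_letter_weight[OF that] by (simp add: ac_simps)
  have "fps_nth (grade (series_sum indices_I (\<lambda>k. h ^ dep k * z k * u_monom A B C k))) d =
      (\<Sum>k | k \<in> indices_I \<and> wt k = d. h ^ dep k * z k * u_monom A B C k)"
  proof (rule grade_series_sum)
    fix k assume k: "k \<in> indices_I"
    show "homog (wt k) (h ^ dep k * z k * u_monom A B C k)"
      unfolding eq[OF ix[OF k]] by (intro homog_mult_left homog_prod_list_letter_weight assms ix k)
  next
    show "finite {k \<in> indices_I. wt k = d}" for d
      unfolding indices_I_wt using finite_wt_indices by simp
  qed
  also have "\<dots> = (\<Sum>k | k \<in> indices_I \<and> wt k = d. prod_list (map (letter_weight h A B C) k) * z k)"
    by (intro sum.cong refl) (simp add: prod_list_letter_weight ix ac_simps)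
  finally show ?thesis unfolding indices_I_wt .
qed

lemma grade_Phi:
  assumes "homog 0 t" "homog 1 A" "homog 1 B" "homog 2 C"
  shows "grade (Phi t A B C) = zgen_last t (letter_weight (1 - 2 * t) A B C)"
proof (rule fps_ext)
  fix d
  have h: "homog 0 (1 - 2 * t)"
    by (intro homog_diff homog_1 homog_mult_left homog_numeral assms)
  show "fps_nth (grade (Phi t A B C)) d = fps_nth (zgen_last t (letter_weight (1 - 2 * t) A B C)) d"
    unfolding Phi_def grade_indices_I[OF h assms(2-4) homog_zeta_t[OF assms(1)]]
    by (simp add: zgen_last_def wt_gf_def sum.inter_filter[symmetric] finite_wt_indices)
qed

text \<open>Identifies the factor x^wt in \<open>zeta_txy\<close> with the substitution of xX, xY,
  x^2 Z on the right-hand side of the theorem.\<close>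

lemma prod_list_letter_weight_scale:
  "is_index k \<Longrightarrow> prod_list (map (letter_weight h (x * A) (x * B) (x\<^sup>2 * C)) k) =
    x ^ wt k * prod_list (map (letter_weight h A B C) k)"
proof (induction k)
  case (Cons a k)
  have "letter_weight h (x * A) (x * B) (x\<^sup>2 * C) a = x ^ a * letter_weight h A B C a"
  proof (cases "a = 1")
    case False
    then have "a \<ge> 2" using Cons.prems by (simp add: is_index_Cons)
    then have "x ^ a = x ^ (a - 2) * x\<^sup>2" by (metis power_add le_add_diff_inverse2)
    then show ?thesis using False by (simp add: letter_weight_def power_mult_distrib)
  qed (simp add: letter_weight_def)
  then show ?case
    using Cons by (simp add: is_index_Cons wt_def power_add)
qed (simp add: wt_def)

lemma is_index_append: "is_index (k @ l) \<longleftrightarrow> is_index k \<and> is_index l"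
  by (auto simp: is_index_def)

lemma is_index_rev: "is_index (rev k) \<longleftrightarrow> is_index k"
  by (simp add: is_index_def)

lemma wt_append: "wt (k @ l) = wt k + wt l"
  by (simp add: wt_def)

lemma wt_rev: "wt (rev k) = wt k"
  by (simp add: wt_def)

text \<open>A cut before the end leaves an arbitrary prefix and a nonempty suffix, whose reversal
  begins with an entry at least 2. The two halves are independent and their weights add, which is a
  product of generating series.\<close>

lemma sum_split_indices:
  fixes \<alpha> \<beta> :: "nat list \<Rightarrow> 'a::comm_ring_1"
  shows "(\<Sum>k | k \<in> wt_indices d \<and> k \<noteq> [] \<and> last k \<ge> 2. \<Sum>i<length k. \<alpha> (take i k) * \<beta> (rev (drop
    i k))) =
    fps_nth (wt_gf \<alpha> * wt_gf (\<lambda>k. if k \<noteq> [] \<and> hd k \<ge> 2 then \<beta> k else 0)) d"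
proof -
  define J where "J = {k \<in> wt_indices d. k \<noteq> [] \<and> last k \<ge> 2}"
  define K where "K = (\<lambda>e. {l \<in> wt_indices (d - e). l \<noteq> [] \<and> hd l \<ge> (2::nat)})"
  have fin: "finite J" "finite (K e)" for e using finite_wt_indices by (simp_all add: J_def K_def)
  have "(\<Sum>k\<in>J. \<Sum>i<length k. \<alpha> (take i k) * \<beta> (rev (drop i k))) =
      (\<Sum>(k, i)\<in>Sigma J (\<lambda>k. {..<length k}). \<alpha> (take i k) * \<beta> (rev (drop i k)))"
    by (rule sum.Sigma) (use fin in auto)
  also have "\<dots> = (\<Sum>(e, k, l)\<in>Sigma {0..d} (\<lambda>e. wt_indices e \<times> K e). \<alpha> k * \<beta> l)"
  proof (rule sum.reindex_bij_witness[where
        i = "\<lambda>(e, k, l). (k @ rev l, length k)" and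
        j = "\<lambda>(k, i). (wt (take i k), take i k, rev (drop i k))"])
    fix p assume p: "p \<in> Sigma J (\<lambda>k. {..<length k})"
    obtain k i where ki: "p = (k, i)" by (cases p)
    have split: "take i k @ drop i k = k" by simp
    have k: "is_index k" "wt k = d" "last k \<ge> 2" "i < length k"
      using p ki by (auto simp: J_def wt_indices_def)
    have ix: "is_index (take i k)" "is_index (drop i k)"
      using k(1) split is_index_append[of "take i k" "drop i k"] by auto
    have w: "wt (take i k) + wt (drop i k) = d"
      using k(2) wt_append[of "take i k" "drop i k"] by simp
    have "hd (rev (drop i k)) \<ge> 2" "drop i k \<noteq> []"
      using k(3,4) by (auto simp: hd_rev last_drop)
    then show "(case p of (k, i) \<Rightarrow> (wt (take i k), take i k, rev (drop i k)))
        \<in> Sigma {0..d} (\<lambda>e. wt_indices e \<times> K e)"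
      using ki ix w by (auto simp: wt_indices_def K_def is_index_rev wt_rev)
    show "(case case p of (k, i) \<Rightarrow> (wt (take i k), take i k, rev (drop i k)) of
        (e, k, l) \<Rightarrow> (k @ rev l, length k)) = p"
      using ki k(4) by simp
    show "(case case p of (k, i) \<Rightarrow> (wt (take i k), take i k, rev (drop i k)) of
        (e, k, l) \<Rightarrow> \<alpha> k * \<beta> l) = (case p of (k, i) \<Rightarrow> \<alpha> (take i k) * \<beta> (rev (drop i k)))"
      using ki by simp
  next
    fix p assume p: "p \<in> Sigma {0..d} (\<lambda>e. wt_indices e \<times> K e)"
    obtain e k l where ekl: "p = (e, k, l)" by (cases p)
    have "e \<le> d" "is_index k" "wt k = e" "is_index l" "wt l = d - e" "l \<noteq> []" "hd l \<ge> 2"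
      using p ekl by (auto simp: wt_indices_def K_def)
    then show "(case p of (e, k, l) \<Rightarrow> (k @ rev l, length k)) \<in> Sigma J (\<lambda>k. {..<length k})"
      using ekl by (auto simp: J_def wt_indices_def is_index_append is_index_rev wt_append
        wt_rev last_rev)
    show "(case case p of (e, k, l) \<Rightarrow> (k @ rev l, length k) of
        (k, i) \<Rightarrow> (wt (take i k), take i k, rev (drop i k))) = p"
      using ekl \<open>wt k = e\<close> by simp
  qed
  also have "\<dots> = (\<Sum>e = 0..d. \<Sum>(k, l)\<in>wt_indices e \<times> K e. \<alpha> k * \<beta> l)"
    by (rule sum.Sigma[symmetric]) (use fin finite_wt_indices in auto)
  also have "\<dots> = (\<Sum>e = 0..d. (\<Sum>k\<in>wt_indices e. \<alpha> k) * (\<Sum>l\<in>K e. \<beta> l))"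
    by (simp add: sum_product sum.cartesian_product)
  also have "\<dots> = fps_nth (wt_gf \<alpha> * wt_gf (\<lambda>k. if k \<noteq> [] \<and> hd k \<ge> 2 then \<beta> k else 0)) d"
    by (simp add: fps_mult_nth wt_gf_def K_def sum.inter_filter[symmetric] finite_wt_indices)
  finally show ?thesis by (simp add: J_def)
qed

text \<open>The cut at \<open>i = length k\<close> is kept apart: its suffix is empty, so
  admissibility constrains the prefix and yields \<open>zgen_last\<close>. All other cuts
  factor.\<close>

lemma grade_Phi_xy:
  assumes "homog 0 t" "homog 0 x" "homog 0 y" "homog 1 A" "homog 1 B" "homog 2 C"
  defines "h \<equiv> 1 - 2 * t"
  shows "grade (Phi_xy t x y A B C) = zgen_last t (letter_weight h (x * A) (x * B) (x\<^sup>2 * C)) +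
    zgen_all t (letter_weight h (x * A) (x * B) (x\<^sup>2 * C)) * zgen_hd t (letter_weight h (y * A)
      (y * B) (y\<^sup>2 * C))"
proof (rule fps_ext)
  fix d
  define \<alpha> where "\<alpha> = (\<lambda>k. prod_list (map (letter_weight h (x * A) (x * B) (x\<^sup>2 * C)) k) *
    zeta_t t k)"
  define \<beta> where "\<beta> = (\<lambda>k. prod_list (map (letter_weight h (y * A) (y * B) (y\<^sup>2 * C)) k) *
    zeta_t t k)"
  have h: "homog 0 h"
    unfolding h_def by (intro homog_diff homog_1 homog_mult_left homog_numeral assms)
  have z: "homog 0 (zeta_txy t x y k)" for k
    unfolding zeta_txy_def
    by (intro homog_sum homog_mult_left homog_power_0 homog_zeta_t assms)
  have term_eq: "prod_list (map (letter_weight h A B C) k) * zeta_txy t x y k =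
      (\<Sum>i<length k. \<alpha> (take i k) * \<beta> (rev (drop i k))) + \<alpha> k" if k: "is_index k" for k
  proof -
    have one: "prod_list (map (letter_weight h A B C) k) *
        (zeta_t t (take i k) * zeta_t t (rev (drop i k)) * x ^ wt (take i k) * y ^ wt (drop i k)) =
        \<alpha> (take i k) * \<beta> (rev (drop i k))" for i
    proof -
      have ix: "is_index (take i k)" "is_index (rev (drop i k))"
        using k is_index_append[of "take i k" "drop i k"] by (simp_all add: is_index_rev)
      have "prod_list (map (letter_weight h A B C) (rev (drop i k))) =
        prod_list (map (letter_weight h A B C) (drop i k))"
        unfolding rev_map[symmetric] by (rule prod_list.rev)
      moreover have "prod_list (map (letter_weight h A B C) k) =
          prod_list (map (letter_weight h A B C) (take i k)) * prod_list (map (letter_weight h A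
            B C) (drop i k))"
        by (simp flip: prod_list.append map_append)
      ultimately have "prod_list (map (letter_weight h A B C) k) =
          prod_list (map (letter_weight h A B C) (take i k)) * prod_list (map (letter_weight h A
            B C) (rev (drop i k)))"
        by (simp only:)
      then show ?thesis
        unfolding \<alpha>_def \<beta>_def prod_list_letter_weight_scale[OF ix(1)]
          prod_list_letter_weight_scale[OF ix(2)] wt_rev
        by (simp only: mult_ac)
    qed
    \<comment> \<open>Weight 0 contains only the empty index, so the constant coefficient of
      \<open>zgen_all\<close> is its value.\<close>
    have "zeta_t t [] = 1"
      using zgen_all_0[of t "\<lambda>_. 1"] by (simp add: zgen_all_def wt_gf_def wt_indices_0)
    then have last: "\<alpha> (take (length k) k) * \<beta> (rev (drop (length k) k)) = \<alpha> k"
      by (simp add: \<beta>_def)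
    have "prod_list (map (letter_weight h A B C) k) * zeta_txy t x y k =
        (\<Sum>i\<le>length k. \<alpha> (take i k) * \<beta> (rev (drop i k)))"
      unfolding zeta_txy_def sum_distrib_left one ..
    then show ?thesis
      unfolding lessThan_Suc_atMost[symmetric] sum.lessThan_Suc last .
  qed
  have "fps_nth (grade (Phi_xy t x y A B C)) d =
      (\<Sum>k | k \<in> wt_indices d \<and> k \<noteq> [] \<and> last k \<ge> 2. prod_list (map (letter_weight h A B C) k) *
        zeta_txy t x y k)"
    unfolding Phi_xy_def h_def[symmetric] by (rule grade_indices_I[OF h assms(4-6) z])
  also have "\<dots> = (\<Sum>k | k \<in> wt_indices d \<and> k \<noteq> [] \<and> last k \<ge> 2.
      (\<Sum>i<length k. \<alpha> (take i k) * \<beta> (rev (drop i k))) + \<alpha> k)"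
    by (intro sum.cong refl term_eq) (simp add: wt_indices_def)
  also have "\<dots> = fps_nth (wt_gf \<alpha> * wt_gf (\<lambda>k. if k \<noteq> [] \<and> hd k \<ge> 2 then \<beta> k else 0)) d +
      (\<Sum>k | k \<in> wt_indices d \<and> k \<noteq> [] \<and> last k \<ge> 2. \<alpha> k)"
    unfolding sum.distrib sum_split_indices ..
  also have "\<dots> = fps_nth (zgen_last t (letter_weight h (x * A) (x * B) (x\<^sup>2 * C)) +
    zgen_all t (letter_weight h (x * A) (x * B) (x\<^sup>2 * C)) * zgen_hd t (letter_weight h (y * A)
      (y * B) (y\<^sup>2 * C))) d"
    by (simp add: zgen_last_def zgen_all_def zgen_hd_def \<alpha>_def[symmetric] \<beta>_def[symmetric])
      (simp add: wt_gf_def \<alpha>_def \<beta>_def sum.inter_filter[symmetric] finite_wt_indices)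
  finally show "fps_nth (grade (Phi_xy t x y A B C)) d =
    fps_nth (zgen_last t (letter_weight h (x * A) (x * B) (x\<^sup>2 * C)) +
    zgen_all t (letter_weight h (x * A) (x * B) (x\<^sup>2 * C)) * zgen_hd t (letter_weight h (y * A)
      (y * B) (y\<^sup>2 * C))) d" .
qed

lemma zeta_log_deriv_scale_nth:
  "fps_nth (zeta_log_deriv (x * e1) (x\<^sup>2 * e2) (x * d1) (x\<^sup>2 * d2)) k =
    real_const (zeta [Suc k]) * x ^ Suc k * (psum e1 e2 (Suc k) - psum d1 d2 (Suc k))"
  unfolding zeta_log_deriv_def fps_nth_Abs_fps psum_scale by (simp add: algebra_simps)

lemma esym_scale:
  "esym1 s (x * A) (x * B) = x * esym1 s A B"
  "esym2 s (x * A) (x * B) (x\<^sup>2 * C) = x\<^sup>2 * esym2 s A B C"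
  by (simp_all add: esym1_def esym2_def algebra_simps power2_eq_square)

text \<open>The parameters have degree 0 and the k-th power sum is homogeneous of degree k, so each
  degree receives at most one term.\<close>

lemma grade_exponent:
  assumes "root_pair s \<gamma> \<delta>" "root_pair s' \<gamma>' \<delta>'"
    and "homog 0 s" "homog 0 s'" "homog 0 x" "homog 0 y"
  defines "e1 \<equiv> esym1 s ind_X ind_Y" and "e2 \<equiv> esym2 s ind_X ind_Y ind_Z"
    and "d1 \<equiv> esym1 s' ind_X ind_Y" and "d2 \<equiv> esym2 s' ind_X ind_Y ind_Z"
  shows "fps_nth (grade (exponent x y \<gamma> \<delta> \<gamma>' \<delta>')) k = (if k \<ge> 2 then
     real_const (zeta [k] / real k) * (x ^ k + y ^ k) * (psum e1 e2 k - psum d1 d2 k) else 0)"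
proof -
  have e: "homog 1 (esym1 r ind_X ind_Y)" "homog 2 (esym2 r ind_X ind_Y ind_Z)" if "homog 0 r" for r
  proof -
    have xy: "homog 2 (ind_X * ind_Y)"
      using homog_mult[OF homog_ind(4,5)] by (simp only: one_add_one)
    show "homog 2 (esym2 r ind_X ind_Y ind_Z)"
      unfolding esym2_def by (rule homog_mult_left[OF that homog_diff[OF xy homog_ind(6)]])
    show "homog 1 (esym1 r ind_X ind_Y)"
      unfolding esym1_def by (intro homog_add homog_mult_left homog_ind that)
  qed
  have "fps_nth (grade (exponent x y \<gamma> \<delta> \<gamma>' \<delta>')) k = (\<Sum>i | i \<in> {2..} \<and> i = k.
     real_const (zeta [i] / real i) * (x ^ i + y ^ i) * (psum e1 e2 i - psum d1 d2 i))"
    unfolding exponent_eq[OF assms(1,2)] e1_def e2_def d1_def d2_def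
    by (intro grade_series_sum homog_mult_left homog_real_const homog_add homog_power_0 homog_diff
        homog_psum e assms(3-6)) simp
  also have "{i. i \<in> {2..} \<and> i = k} = (if k \<ge> 2 then {k} else {})" by auto
  finally show ?thesis by simp
qed

theorem theorem1p3:
  fixes \<gamma> \<delta> \<gamma>' \<delta>' :: "series fract alg_closure"
  assumes "root_pair (ind_t * (1 - 2 * ind_t)) \<gamma> \<delta>"
    and "root_pair ((1 - ind_t) * (2 * ind_t - 1)) \<gamma>' \<delta>'"
  shows "Phi_xy ind_t ind_x ind_y ind_X ind_Y ind_Z \<in> mzv_series \<and>
    Phi ind_t (ind_x * ind_X) (ind_x * ind_Y) (ind_x\<^sup>2 * ind_Z) \<in> mzv_series \<and>
    Phi (1 - ind_t) (ind_y * ind_X) (ind_y * ind_Y) (ind_y\<^sup>2 * ind_Z) \<in> mzv_series \<and>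
    exponent ind_x ind_y \<gamma> \<delta> \<gamma>' \<delta>' \<in> mzv_series \<and>
    Phi_xy ind_t ind_x ind_y ind_X ind_Y ind_Z =
      Phi ind_t (ind_x * ind_X) (ind_x * ind_Y) (ind_x\<^sup>2 * ind_Z) -
      Phi (1 - ind_t) (ind_y * ind_X) (ind_y * ind_Y) (ind_y\<^sup>2 * ind_Z) *
        series_exp (exponent ind_x ind_y \<gamma> \<delta> \<gamma>' \<delta>')"
proof (intro conjI)
  show "Phi_xy ind_t ind_x ind_y ind_X ind_Y ind_Z \<in> mzv_series"
    by (intro Phi_xy_mzv_series ind_mzv_series)
  show "Phi ind_t (ind_x * ind_X) (ind_x * ind_Y) (ind_x\<^sup>2 * ind_Z) \<in> mzv_series"
    "Phi (1 - ind_t) (ind_y * ind_X) (ind_y * ind_Y) (ind_y\<^sup>2 * ind_Z) \<in> mzv_series"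
    by (intro Phi_mzv_series mzv_series_intros ind_mzv_series)+
  show "exponent ind_x ind_y \<gamma> \<delta> \<gamma>' \<delta>' \<in> mzv_series"
    by (rule exponent_mzv_series[OF assms]) (intro mzv_series_intros ind_mzv_series)+
  define h where "h = 1 - 2 * ind_t"
  define s where "s = ind_t * h"
  \<comment> \<open>(t - 1)(1 - 2t) = (1 - t)(2t - 1), the parameter of \<gamma>' and
    \<delta>'.\<close>
  define s' where "s' = (ind_t - 1) * h"
  define e1 where "e1 = esym1 s ind_X ind_Y"
  define e2 where "e2 = esym2 s ind_X ind_Y ind_Z"
  define d1 where "d1 = esym1 s' ind_X ind_Y"
  define d2 where "d2 = esym2 s' ind_X ind_Y ind_Z"
  define E where "E = exponent ind_x ind_y \<gamma> \<delta> \<gamma>' \<delta>'"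
  define U where "U = (\<lambda>h z. letter_weight h (z * ind_X) (z * ind_Y) (z\<^sup>2 * ind_Z))"
  define G where "G = (\<lambda>z. zgen_all ind_t (U h z))"
  define K where "K = (\<lambda>z. zeta_log_deriv (z * e1) (z\<^sup>2 * e2) (z * d1) (z\<^sup>2 * d2))"
  have rp: "root_pair s \<gamma> \<delta>" "root_pair s' \<gamma>' \<delta>'"
    using assms by (simp_all add: s_def s'_def h_def algebra_simps)
  have hom_h: "homog 0 h"
    unfolding h_def by (intro homog_diff homog_1 homog_mult_left homog_numeral homog_ind)
  have hom_s: "homog 0 s" "homog 0 s'"
    unfolding s_def s'_def by (intro homog_mult_left homog_diff homog_1 homog_ind hom_h)+
  have G': "fps_deriv (G z) = G z * K z" for z
    unfolding G_def U_def K_def deriv_zgen_all esym_scale e1_def e2_def d1_def d2_def s_def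
      s'_def ..
  note gradeE = grade_exponent[OF rp hom_s homog_ind(2,3), folded E_def e1_def e2_def d1_def d2_def]
  have E0: "fps_nth (grade E) 0 = 0" by (simp add: gradeE)
  have E': "fps_deriv (grade E) = K ind_x + K ind_y"
  proof (rule fps_ext)
    fix k
    show "fps_nth (fps_deriv (grade E)) k = fps_nth (K ind_x + K ind_y) k"
    proof (cases "k = 0")
      \<comment> \<open>This is the term k = 1, from which the exponent is free; in the logarithmic
        derivatives it vanishes because zeta(1) = 0.\<close>
      case True
      then show ?thesis by (simp add: gradeE K_def zeta_log_deriv_scale_nth zeta_one[simplified])
    next
      case False
      have "of_nat (Suc k) * real_const (zeta [Suc k] / real (Suc k)) = real_const (zeta [Suc k])"
        unfolding real_const_of_nat[symmetric] real_const_mult[symmetric] by (simp del: of_nat_Suc)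
      then have "fps_nth (fps_deriv (grade E)) k = real_const (zeta [Suc k]) *
          (ind_x ^ Suc k + ind_y ^ Suc k) * (psum e1 e2 (Suc k) - psum d1 d2 (Suc k))"
        using False by (simp add: gradeE mult.assoc[symmetric] del: of_nat_Suc power_Suc psum.simps)
      then show ?thesis
        unfolding K_def fps_add_nth zeta_log_deriv_scale_nth by
          (simp only: distrib_left distrib_right)
    qed
  qed
  \<comment> \<open>Both sides solve F' = F (K(x) + K(y)) with constant term 1.\<close>
  have exp: "grade (series_exp E) = G ind_x * G ind_y"
  proof (rule ode_unique)
    show "fps_deriv (grade (series_exp E)) = grade (series_exp E) * (K ind_x + K ind_y)"
      unfolding deriv_grade_series_exp[OF E0] E' ..
    show "fps_deriv (G ind_x * G ind_y) = G ind_x * G ind_y * (K ind_x + K ind_y)"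
      by (simp add: G' algebra_simps)
    show "fps_nth (grade (series_exp E)) 0 = fps_nth (G ind_x * G ind_y) 0"
      by (simp add: grade_series_exp_0[OF E0] G_def zgen_all_0)
  qed
  have hom_scale: "homog 1 (z * ind_X)" "homog 1 (z * ind_Y)" "homog 2 (z\<^sup>2 * ind_Z)" if "homog
    0 z" for z
    using that by (intro homog_mult_left homog_power_0 homog_ind; simp)+
  \<comment> \<open>Since 1 - 2(1 - t) = -(1 - 2t), negating the letters amounts to replacing t by 1
    - t in the factor (1 - 2t)^dep.\<close>
  have "(\<lambda>a. - U h ind_y a) = U (1 - 2 * (1 - ind_t)) ind_y"
    by (auto simp: U_def letter_weight_def h_def algebra_simps)
  then have hd_eq: "zgen_hd ind_t (U h ind_y) =
      - zgen_last (1 - ind_t) (U (1 - 2 * (1 - ind_t)) ind_y) * G ind_y"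
    unfolding zgen_hd_eq G_def by simp
  have hom_t: "homog 0 (1 - ind_t)" by (intro homog_diff homog_1 homog_ind)
  have "grade (Phi_xy ind_t ind_x ind_y ind_X ind_Y ind_Z) =
      zgen_last ind_t (U h ind_x) + G ind_x * zgen_hd ind_t (U h ind_y)"
    unfolding U_def G_def h_def by (rule grade_Phi_xy[OF homog_ind])
  also have "\<dots> = zgen_last ind_t (U h ind_x) -
      zgen_last (1 - ind_t) (U (1 - 2 * (1 - ind_t)) ind_y) * (G ind_x * G ind_y)"
    unfolding hd_eq by (simp add: algebra_simps)
  also have "\<dots> = grade (Phi ind_t (ind_x * ind_X) (ind_x * ind_Y) (ind_x\<^sup>2 * ind_Z) -
      Phi (1 - ind_t) (ind_y * ind_X) (ind_y * ind_Y) (ind_y\<^sup>2 * ind_Z) * series_exp E)"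
    unfolding grade_diff grade_mult exp grade_Phi[OF homog_ind(1) hom_scale[OF homog_ind(2)]]
      grade_Phi[OF hom_t hom_scale[OF homog_ind(3)]] U_def h_def ..
  finally show "Phi_xy ind_t ind_x ind_y ind_X ind_Y ind_Z =
      Phi ind_t (ind_x * ind_X) (ind_x * ind_Y) (ind_x\<^sup>2 * ind_Z) -
      Phi (1 - ind_t) (ind_y * ind_X) (ind_y * ind_Y) (ind_y\<^sup>2 * ind_Z) *
        series_exp (exponent ind_x ind_y \<gamma> \<delta> \<gamma>' \<delta>')"
    unfolding E_def by (rule inj_grade)
qed

end
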